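(* Let $\alpha \in \mathbb{T}$ be irrational, let $k \ge 2$, and let $T : \mathbb{T}^k \to \mathbb{T}^k$ be given by $$T(\omega_1 , \omega_2 , \ldots , \omega_k) = ( \omega_1 + \alpha , \omega_2 + \omega_1 , \ldots , \omega_k + \omega_{k-1} ).$$ Then: (a) For every $k \ge 2$, $T$ has (TRP) if and only if $\liminf_{q \to \infty} q^{k-1} \langle q \alpha \rangle = 0$. (b) For $k = 2$, the following are equivalent: $T$ has (TRP); $T$ has (MRP); $T$ has (GRP); $\liminf_{q \to \infty} q \langle q \alpha \rangle = 0$. (c) If $k \ge 3$, then $T$ does not have (GRP). (d) If $k \ge 3$, then for Lebesgue almost every $\alpha$, $T$ does not have (TRP). (e) If $k = 3$, then $T$ has (MRP) for all $\alpha$ in some residual subset of $\mathbb{T}$. (f) If $k \ge 4$, then $T$ does not have (MRP).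
   Context: $\mathbb{T} = \mathbb{R}/\mathbb{Z}$. For $\tau \in \mathbb{T}$, $\langle \tau \rangle = \min\{ |\hat\tau - p| : p \in \mathbb{Z}\}$ for any representative $\hat\tau \in \mathbb{R}$ of $\tau$ (for real $x$, $\langle x\rangle$ means $\langle x \bmod 1\rangle$). The metric on $\mathbb{T}^k$ is $\mathrm{dist}(x,y) = \sum_{j=1}^k \langle x_j - y_j \rangle$. $\mathbb{Z}_+ = \{1,2,3,\ldots\}$. A sequence $\{\omega_n\}_{n\ge0}$ in a metric space $\Omega$ has the repetition property if for every $\varepsilon>0$ and $r \in \mathbb{Z}_+$ there exists $q \in \mathbb{Z}_+$ such that $\mathrm{dist}(\omega_n,\omega_{n+q}) < \varepsilon$ for $n = 0,1,\ldots, rq$. For a map $T:\Omega\to\Omega$, $PRP(T)$ is the set of $\omega\in\Omega$ whose forward orbit $\{T^n\omega\}_{n\ge0}$ has the repetition property. $T$ has the topological repetition property (TRP) if $PRP(T)\neq\emptyset$, the metric repetition property (MRP) if $\mu(PRP(T))>0$, and the global repetition property (GRP) if $PRP(T)=\Omega$. Here (MRP) is taken with respect to normalized Lebesgue measure $\mu$ on $\mathbb{T}^k$ (the unique $T$-invariant probability measure). *)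

theory Defs
  imports "HOL-Analysis.Analysis"
begin

definition tnorm :: "real \<Rightarrow> real" where
  "tnorm x = min (frac x) (1 - frac x)"

definition torus :: "nat \<Rightarrow> (nat \<Rightarrow> real) set" where
  "torus k = PiE {..<k} (\<lambda>_. {0..<1})"

definition tdist :: "nat \<Rightarrow> (nat \<Rightarrow> real) \<Rightarrow> (nat \<Rightarrow> real) \<Rightarrow> real" where
  "tdist k x y = (\<Sum>j<k. tnorm (x j - y j))"

definition repetition :: "nat \<Rightarrow> (nat \<Rightarrow> (nat \<Rightarrow> real)) \<Rightarrow> bool" where
  "repetition k w \<longleftrightarrow>
     (\<forall>\<epsilon>>0. \<forall>r::nat. r \<ge> 1 \<longrightarrow>
        (\<exists>q::nat. q \<ge> 1 \<and> (\<forall>n \<le> r * q. tdist k (w n) (w (n + q)) < \<epsilon>)))"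

definition skew :: "nat \<Rightarrow> real \<Rightarrow> (nat \<Rightarrow> real) \<Rightarrow> (nat \<Rightarrow> real)" where
  "skew k \<alpha> w = (\<lambda>j. if j < k then frac (w j + (if j = 0 then \<alpha> else w (j - 1))) else undefined)"

definition PRP :: "nat \<Rightarrow> real \<Rightarrow> (nat \<Rightarrow> real) set" where
  "PRP k \<alpha> = {w \<in> torus k. repetition k (\<lambda>n. (skew k \<alpha> ^^ n) w)}"

definition TRP :: "nat \<Rightarrow> real \<Rightarrow> bool" where
  "TRP k \<alpha> \<longleftrightarrow> PRP k \<alpha> \<noteq> {}"

definition GRP :: "nat \<Rightarrow> real \<Rightarrow> bool" where
  "GRP k \<alpha> \<longleftrightarrow> PRP k \<alpha> = torus k"

text \<open>Positive (outer) Lebesgue measure: not a null set of the completed Lebesgue measure on R^k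
  (restricted to [0,1)^k this is normalized Lebesgue measure on T^k).\<close>
definition MRP :: "nat \<Rightarrow> real \<Rightarrow> bool" where
  "MRP k \<alpha> \<longleftrightarrow> PRP k \<alpha> \<notin> null_sets (completion (PiM {..<k} (\<lambda>_. lborel)))"

definition residual :: "real set \<Rightarrow> bool" where
  "residual R \<longleftrightarrow> (\<exists>U :: nat \<Rightarrow> real set.
      (\<forall>n. open (U n) \<and> closure (U n) = UNIV) \<and> (\<Inter>n. U n) \<subseteq> R)"

end

theory Submission
  imports Defs
begin

text \<open>Along an orbit the differences \<open>\<omega>\<^sub>j(n + q) - \<omega>\<^sub>j(n)\<close> are polynomials in \<open>n\<close> of degree \<open>j\<close>
  with leading term governed by \<open>q\<alpha>\<close>. If all of them stay close to \<open>0\<close> mod 1 for \<open>n \<le> rq\<close>, their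
  small representatives are genuine polynomials, and differences with step \<open>q\<close> show that
  \<open>q\<^sup>k\<^sup>-\<^sup>1\<langle>q\<alpha>\<rangle>\<close> and \<open>q\<^sup>k\<^sup>-\<^sup>2\<langle>q\<omega>\<^sub>1 + (q choose 2)\<alpha>\<rangle>\<close> are small. The negative claims follow: by
  Borel--Cantelli for almost every \<open>\<alpha>\<close> or \<open>\<omega>\<^sub>1\<close>, and by taking \<open>\<omega>\<^sub>1 = \<surd>2\<close> for the failure of
  (GRP). Conversely, if \<open>q\<^sup>k\<^sup>-\<^sup>1\<langle>q\<alpha>\<rangle>\<close> is small, then the orbit of \<open>0\<close> repeats with period
  \<open>k! q\<close>, the factorial clearing the denominators of the binomial coefficients. For \<open>k = 2, 3\<close>
  the coordinate \<open>\<omega>\<^sub>k\<^sub>-\<^sub>1\<close> may be arbitrary: replacing \<open>q\<close> by a bounded multiple supplied by Dirichlet's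
  theorem makes \<open>q\<omega>\<^sub>k\<^sub>-\<^sub>1\<close> small. For \<open>k = 3\<close> and \<open>\<alpha>\<close> very close to a rational \<open>a/b\<close>, all
  multiples \<open>bm\<close> with \<open>m \<le> M\<close> are good for \<open>\<alpha>\<close>, and since badly approximable numbers form a null
  set, most \<open>\<omega>\<^sub>1\<close> satisfy \<open>bm\<langle>bm\<omega>\<^sub>1\<rangle> < \<epsilon>\<close> for one of them.\<close>

subsection \<open>Distance to the nearest integer\<close>

lemma tnorm_nonneg: "0 \<le> tnorm x"
  unfolding tnorm_def using frac_lt_1[of x] by simp

text \<open>With \<open>tnorm_eq_dist\<close> this identifies the formula by \<open>frac\<close>
  with the distance to the nearest integer. Subadditivity and the bound for integer multiples rest
  on these two facts.\<close>

lemma tnorm_le_dist_Ints: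
  assumes "p \<in> \<int>"
  shows "tnorm x \<le> \<bar>x - p\<bar>"
proof -
  obtain m where m: "p = of_int m" using assms by (auto elim: Ints_cases)
  show ?thesis
  proof (cases "m \<le> \<lfloor>x\<rfloor>")
    case True
    then have "frac x \<le> x - p" by (simp add: frac_def m)
    then show ?thesis by (simp add: tnorm_def)
  next
    case False
    then have "of_int m \<ge> (of_int \<lfloor>x\<rfloor> + 1 :: real)" by linarith
    then have "1 - frac x \<le> p - x" by (simp add: frac_def m)
    then show ?thesis by (simp add: tnorm_def)
  qed
qed

lemma tnorm_eq_dist:
  obtains p :: int where "tnorm x = \<bar>x - of_int p\<bar>"
proof (cases "frac x \<le> 1 - frac x")
  case True
  then have "tnorm x = \<bar>x - of_int \<lfloor>x\<rfloor>\<bar>" by (simp add: tnorm_def frac_def)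
  then show ?thesis using that by blast
next
  case False
  have "frac x < 1" by (rule frac_lt_1)
  with False have "tnorm x = \<bar>x - of_int (\<lfloor>x\<rfloor> + 1)\<bar>"
    by (auto simp: tnorm_def frac_def)
  then show ?thesis using that by blast
qed

lemma tnorm_le_abs: "tnorm x \<le> \<bar>x\<bar>"
  using tnorm_le_dist_Ints[of 0 x] by simp

lemma tnorm_cong:
  assumes "x - y \<in> \<int>"
  shows "tnorm x = tnorm y"
proof -
  have "frac x = frac (y + (x - y))" by simp
  also have "\<dots> = frac y" using assms by (rule frac_add_int_right)
  finally show ?thesis by (simp add: tnorm_def)
qed

lemma tnorm_minus: "tnorm (- x) = tnorm x"
  by (auto simp: tnorm_def frac_neg min.commute simp flip: frac_eq_0_iff)

lemma tnorm_add: "tnorm (x + y) \<le> tnorm x + tnorm y"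
proof -
  obtain p q :: int where "tnorm x = \<bar>x - of_int p\<bar>" "tnorm y = \<bar>y - of_int q\<bar>"
    using tnorm_eq_dist by metis
  moreover have "tnorm (x + y) \<le> \<bar>x + y - (of_int p + of_int q)\<bar>"
    by (rule tnorm_le_dist_Ints) simp
  ultimately show ?thesis by linarith
qed

lemma tnorm_sum: "tnorm (\<Sum>i\<in>A. f i) \<le> (\<Sum>i\<in>A. tnorm (f i))"
proof (induction A rule: infinite_finite_induct)
  case (insert a A)
  then show ?case using tnorm_add[of "f a" "sum f A"] by simp
qed (simp_all add: tnorm_def)

lemma tnorm_nat_mult: "tnorm (real n * x) \<le> real n * tnorm x"
proof -
  obtain p :: int where p: "tnorm x = \<bar>x - of_int p\<bar>" using tnorm_eq_dist by metis
  have "tnorm (real n * x) \<le> \<bar>real n * x - real n * of_int p\<bar>"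
    by (rule tnorm_le_dist_Ints) simp
  also have "\<dots> = real n * \<bar>x - of_int p\<bar>" by (simp add: abs_mult flip: right_diff_distrib)
  finally show ?thesis by (simp add: p)
qed

lemma tnorm_nat_mult_pos:
  assumes "\<alpha> \<notin> \<rat>" "q \<ge> 1"
  shows "0 < tnorm (real q * \<alpha>)"
proof (rule ccontr)
  assume "\<not> ?thesis"
  then have "tnorm (real q * \<alpha>) = 0" using tnorm_nonneg[of "real q * \<alpha>"] by linarith
  then obtain p :: int where "real q * \<alpha> = of_int p"
    using tnorm_eq_dist[of "real q * \<alpha>"] by (metis abs_eq_0_iff eq_iff_diff_eq_0)
  then have "\<alpha> = of_int p / real q" using assms(2) by (simp add: field_simps)
  then show False using assms(1) by auto
qed

lemma Dirichlet_tnorm: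
  assumes "M \<ge> 1"
  obtains m where "1 \<le> m" "m \<le> M" "tnorm (real m * x) < 1 / real M"
proof -
  obtain h k where hk: "0 < k" "k \<le> int M" "\<bar>of_int k * x - of_int h\<bar> < 1 / real M"
    by (rule Dirichlet_approx[of M x]) (use assms in auto)
  have "tnorm (real (nat k) * x) \<le> \<bar>of_int k * x - of_int h\<bar>"
    using tnorm_le_dist_Ints[of "of_int h" "real (nat k) * x"] hk(1) by simp
  then show ?thesis using hk that[of "nat k"] by linarith
qed

lemma borel_measurable_tnorm [measurable]: "tnorm \<in> borel_measurable borel"
  unfolding tnorm_def frac_def by measurable

text \<open>Subadditivity makes \<open>tnorm\<close> 1-Lipschitz. Continuity is what makes the sets
  of badly approximable numbers closed.\<close>

lemma continuous_on_tnorm [continuous_intros]: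
  assumes "continuous_on S f"
  shows "continuous_on S (\<lambda>x. tnorm (f x))"
proof -
  have lip: "\<bar>tnorm x - tnorm y\<bar> \<le> \<bar>x - y\<bar>" for x y
    using tnorm_add[of "x - y" y] tnorm_add[of "y - x" x] tnorm_le_abs[of "x - y"]
      tnorm_le_abs[of "y - x"] by (simp add: abs_le_iff)
  have "continuous_on UNIV tnorm"
    unfolding continuous_on_iff by (metis UNIV_I dist_real_def le_less_trans lip)
  then show ?thesis using assms continuous_on_compose2 by blast
qed

subsection \<open>Orbits of the skew product\<close>

text \<open>Coordinates are shifted by one: entry \<^term>\<open>0\<close> is the constant \<open>\<alpha>\<close>, so that the skew
  product becomes the uniform recursion \<open>x\<^sub>j \<mapsto> x\<^sub>j + x\<^sub>j\<^sub>-\<^sub>1\<close>, carried out in the reals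
  without reduction mod 1.\<close>

primrec lift_orbit :: "real \<Rightarrow> (nat \<Rightarrow> real) \<Rightarrow> nat \<Rightarrow> nat \<Rightarrow> real" where
  "lift_orbit \<alpha> w 0 j = (case j of 0 \<Rightarrow> \<alpha> | Suc i \<Rightarrow> w i)"
| "lift_orbit \<alpha> w (Suc n) j =
     lift_orbit \<alpha> w n j + (case j of 0 \<Rightarrow> 0 | Suc i \<Rightarrow> lift_orbit \<alpha> w n i)"

text \<open>Taken on the real lift, so that the recursion in \<open>n\<close> is exact. The shift
  \<open>Suc j\<close> matches torus coordinate \<open>j\<close>, because lifted coordinate
  \<open>0\<close> is the constant \<alpha>.\<close>

definition gap :: "real \<Rightarrow> (nat \<Rightarrow> real) \<Rightarrow> nat \<Rightarrow> nat \<Rightarrow> nat \<Rightarrow> real" where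
  "gap \<alpha> w q j n = lift_orbit \<alpha> w (n + q) (Suc j) - lift_orbit \<alpha> w n (Suc j)"

lemma lift_orbit_0 [simp]: "lift_orbit \<alpha> w n 0 = \<alpha>"
  by (induction n) auto

lemma lift_orbit_1: "lift_orbit \<alpha> w n (Suc 0) = w 0 + real n * \<alpha>"
  by (induction n) (auto simp: algebra_simps)

lemma lift_orbit_2:
  "lift_orbit \<alpha> w n (Suc (Suc 0)) = w 1 + real n * w 0 + real (n choose 2) * \<alpha>"
proof (induction n)
  case (Suc n)
  have "Suc n choose 2 = n + (n choose 2)"
    by (simp add: numeral_2_eq_2)
  then show ?case using Suc by (simp add: lift_orbit_1 algebra_simps)
qed (auto simp: numeral_2_eq_2)

text \<open>Newton expansion in binomial coefficients. For arbitrary \<open>w\<close> only the gaps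
  of index at most 2 are evaluated explicitly, so the expansions stop at degree three.\<close>

lemma lift_orbit_3:
  "lift_orbit \<alpha> w n (Suc (Suc (Suc 0))) =
     w 2 + real n * w 1 + real (n choose 2) * w 0 + real (n choose 3) * \<alpha>"
proof (induction n)
  case (Suc n)
  have "Suc n choose 2 = n + (n choose 2)" "Suc n choose 3 = (n choose 2) + (n choose 3)"
    by (simp_all add: numeral_2_eq_2 numeral_3_eq_3)
  then show ?case using Suc by (simp add: lift_orbit_2 algebra_simps)
qed (auto simp: numeral_2_eq_2 numeral_3_eq_3)

text \<open>The recursion of the lift is Pascal's rule, and \<alpha> is the only nonzero initial
  value that reaches coordinate \<open>j\<close>.\<close>

lemma lift_orbit_zero:
  assumes "\<And>i. i < j \<Longrightarrow> w i = 0"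
  shows "lift_orbit \<alpha> w n j = real (n choose j) * \<alpha>"
  using assms
proof (induction n arbitrary: j)
  case 0
  then show ?case by (cases j) auto
next
  case (Suc n)
  show ?case
  proof (cases j)
    case (Suc i)
    have "lift_orbit \<alpha> w n i = real (n choose i) * \<alpha>"
      by (rule Suc.IH) (use Suc Suc.prems in auto)
    then show ?thesis using Suc Suc.IH[OF Suc.prems] by (simp add: algebra_simps)
  qed simp
qed

text \<open>Each application of \<open>frac\<close> changes a coordinate by an integer, and the
  recursion only adds coordinates, so all accumulated errors stay integers.\<close>

lemma skew_iter_lift:
  assumes "j < k"
  shows "(skew k \<alpha> ^^ n) w j - lift_orbit \<alpha> w n (Suc j) \<in> \<int>"
  using assms
proof (induction n arbitrary: j)
  case (Suc n)
  let ?v = "(skew k \<alpha> ^^ n) w"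
  define s where "s = ?v j + (if j = 0 then \<alpha> else ?v (j - 1))"
  have 1: "frac s - s \<in> \<int>" by (simp add: frac_def)
  have 2: "s - lift_orbit \<alpha> w (Suc n) (Suc j) \<in> \<int>"
  proof (cases j)
    case 0
    then show ?thesis using Suc by (simp add: s_def)
  next
    case (Suc i)
    have "?v j - lift_orbit \<alpha> w n (Suc j) + (?v i - lift_orbit \<alpha> w n (Suc i)) \<in> \<int>"
      using Suc.IH[of j] Suc.IH[of i] Suc.prems Suc by auto
    then show ?thesis using Suc by (simp add: s_def algebra_simps)
  qed
  have "(skew k \<alpha> ^^ Suc n) w j = frac s"
    using Suc.prems by (simp add: skew_def s_def)
  then show ?case using Ints_add[OF 1 2] by (simp only: diff_add_cancel add_diff_eq)
qed simp

lemma tnorm_orbit_diff: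
  assumes "j < k"
  shows "tnorm ((skew k \<alpha> ^^ n) w j - (skew k \<alpha> ^^ (n + q)) w j) = tnorm (gap \<alpha> w q j n)"
proof -
  have "tnorm ((skew k \<alpha> ^^ n) w j - (skew k \<alpha> ^^ (n + q)) w j)
      = tnorm (lift_orbit \<alpha> w n (Suc j) - lift_orbit \<alpha> w (n + q) (Suc j))"
    using Ints_diff[OF skew_iter_lift[OF assms, where n = n and w = w and \<alpha> = \<alpha>]
      skew_iter_lift[OF assms, where n = "n + q" and w = w and \<alpha> = \<alpha>]]
    by (intro tnorm_cong) (simp add: algebra_simps)
  also have "\<dots> = tnorm (gap \<alpha> w q j n)"
    using tnorm_minus[of "gap \<alpha> w q j n"] by (simp add: gap_def)
  finally show ?thesis .
qed

section \<open>Gaps between an orbit and its shift by \<open>q\<close>\<close>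

lemma tdist_orbit_gap:
  "tdist k ((skew k \<alpha> ^^ n) w) ((skew k \<alpha> ^^ (n + q)) w) = (\<Sum>j<k. tnorm (gap \<alpha> w q j n))"
  unfolding tdist_def by (intro sum.cong refl) (simp add: tnorm_orbit_diff)

lemma gap_0: "gap \<alpha> w q 0 n = real q * \<alpha>"
  by (simp add: gap_def lift_orbit_1 algebra_simps)

lemma gap_Suc: "gap \<alpha> w q (Suc j) (Suc n) = gap \<alpha> w q (Suc j) n + gap \<alpha> w q j n"
  by (simp add: gap_def)

lemma gap_1: "gap \<alpha> w q 1 0 = real q * w 0 + real (q choose 2) * \<alpha>"
  by (simp add: gap_def lift_orbit_2)

lemma gap_2:
  "gap \<alpha> w q 2 0 = real q * w 1 + real (q choose 2) * w 0 + real (q choose 3) * \<alpha>"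
  using lift_orbit_3[of \<alpha> w q] by (simp add: gap_def numeral_2_eq_2)

lemma gap_zero:
  assumes "\<And>i. i \<le> j \<Longrightarrow> w i = 0"
  shows "gap \<alpha> w q j 0 = real (q choose Suc j) * \<alpha>"
  using assms by (simp add: gap_def lift_orbit_zero less_Suc_eq_le)

text \<open>Discrete integration: gap \<open>j + 1\<close> at \<open>n\<close> is its initial value
  plus the sum of gap \<open>j\<close> over all \<open>m < n\<close>. The bound for gap
  \<open>j\<close> is monotone in \<open>n\<close>, so each of these \<open>n\<close> terms may be
  replaced by the bound at \<open>n\<close>.\<close>

lemma tnorm_gap_le:
  "tnorm (gap \<alpha> w q j n) \<le> (\<Sum>i\<le>j. real n ^ i * tnorm (gap \<alpha> w q (j - i) 0))"
proof (induction j arbitrary: n)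
  case 0
  then show ?case by (simp add: gap_0)
next
  case (Suc j)
  let ?B = "\<lambda>n j. \<Sum>i\<le>j. real n ^ i * tnorm (gap \<alpha> w q (j - i) 0)"
  have "gap \<alpha> w q (Suc j) n = gap \<alpha> w q (Suc j) 0 + (\<Sum>m<n. gap \<alpha> w q j m)"
    by (induction n) (auto simp: gap_Suc)
  then have "tnorm (gap \<alpha> w q (Suc j) n) = tnorm (gap \<alpha> w q (Suc j) 0 + (\<Sum>m<n. gap \<alpha> w q j m))"
    by simp
  then have "tnorm (gap \<alpha> w q (Suc j) n)
      \<le> tnorm (gap \<alpha> w q (Suc j) 0) + (\<Sum>m<n. tnorm (gap \<alpha> w q j m))"
    using tnorm_add[of "gap \<alpha> w q (Suc j) 0" "\<Sum>m<n. gap \<alpha> w q j m"]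
      tnorm_sum[of "gap \<alpha> w q j" "{..<n}"] by linarith
  also have "(\<Sum>m<n. tnorm (gap \<alpha> w q j m)) \<le> (\<Sum>m<n. ?B n j)"
  proof (rule sum_mono)
    fix m assume "m \<in> {..<n}"
    then have "?B m j \<le> ?B n j"
      by (intro sum_mono mult_right_mono power_mono) (auto simp: tnorm_nonneg)
    with Suc.IH[of m] show "tnorm (gap \<alpha> w q j m) \<le> ?B n j" by linarith
  qed
  also have "tnorm (gap \<alpha> w q (Suc j) 0) + (\<Sum>m<n. ?B n j) = ?B n (Suc j)"
    by (simp add: sum.atMost_Suc_shift sum_distrib_left mult.assoc del: sum.atMost_Suc)
  finally show ?case by simp
qed

text \<open>Reduces repetition to the gaps at time 0. For \<open>n \<le> r * q\<close> the factor
  \<open>n ^ i\<close> is at most \<open>r ^ i * q ^ i\<close>, and the weight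
  \<open>q ^ (k - 1 - (j - i))\<close> of gap \<open>j - i\<close> dominates \<open>q ^ i\<close>
  since \<open>j < k\<close>; the powers of \<open>r\<close> are absorbed by shrinking
  \<open>e\<close>.\<close>

lemma repetition_skewI:
  assumes "\<And>e. e > 0 \<Longrightarrow>
    \<exists>q\<ge>1. \<forall>j<k. real q ^ (k - 1 - j) * tnorm (gap \<alpha> w q j 0) \<le> e"
  shows "repetition k (\<lambda>n. (skew k \<alpha> ^^ n) w)"
  unfolding repetition_def
proof (intro allI impI)
  fix e :: real and r :: nat
  assume "e > 0" and r: "r \<ge> 1"
  \<comment> \<open>At most \<open>k\<close> summands in each of \<open>k\<close> coordinates, each
    bounded by \<open>r ^ k * d\<close>; the extra 1 makes the final inequality strict.\<close>
  define C where "C = real (k * k) * real r ^ k + 1"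
  have C: "C > 0" unfolding C_def by (intro add_nonneg_pos mult_nonneg_nonneg) auto
  define d where "d = e / C"
  have d: "d > 0" using \<open>e > 0\<close> C by (simp add: d_def)
  obtain q where q: "q \<ge> 1" "\<And>j. j < k \<Longrightarrow> real q ^ (k - 1 - j) * tnorm (gap \<alpha> w q j 0) \<le> d"
    using assms[OF d] by blast
  have "(\<Sum>j<k. tnorm (gap \<alpha> w q j n)) < e" if n: "n \<le> r * q" for n
  proof -
    have summand: "real n ^ i * tnorm (gap \<alpha> w q (j - i) 0) \<le> real r ^ k * d"
      if "i \<le> j" "j < k" for i j
    proof -
      have "real n ^ i \<le> real (r * q) ^ i" using n by (intro power_mono) (simp_all flip: of_nat_mult)
      also have "\<dots> = real r ^ i * real q ^ i" by (simp add: power_mult_distrib)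
      also have "\<dots> \<le> real r ^ k * real q ^ (k - 1 - (j - i))"
        using that q(1) r by (intro mult_mono power_increasing) auto
      finally have "real n ^ i * tnorm (gap \<alpha> w q (j - i) 0)
          \<le> real r ^ k * real q ^ (k - 1 - (j - i)) * tnorm (gap \<alpha> w q (j - i) 0)"
        by (rule mult_right_mono) (rule tnorm_nonneg)
      also have "\<dots> = real r ^ k * (real q ^ (k - 1 - (j - i)) * tnorm (gap \<alpha> w q (j - i) 0))"
        by simp
      also have "\<dots> \<le> real r ^ k * d"
        using that by (intro mult_left_mono q(2)) auto
      finally show ?thesis .
    qed
    have "(\<Sum>j<k. tnorm (gap \<alpha> w q j n)) \<le> (\<Sum>j<k. real k * (real r ^ k * d))"
    proof (rule sum_mono)
      fix j assume j: "j \<in> {..<k}"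
      have "tnorm (gap \<alpha> w q j n) \<le> (\<Sum>i\<le>j. real n ^ i * tnorm (gap \<alpha> w q (j - i) 0))"
        by (rule tnorm_gap_le)
      also have "\<dots> \<le> (\<Sum>i\<le>j. real r ^ k * d)"
        using j by (intro sum_mono summand) auto
      also have "\<dots> = real (Suc j) * (real r ^ k * d)" by simp
      also have "\<dots> \<le> real k * (real r ^ k * d)"
        using j d by (intro mult_right_mono) auto
      finally show "tnorm (gap \<alpha> w q j n) \<le> real k * (real r ^ k * d)" .
    qed
    also have "\<dots> = (C - 1) * d" by (simp add: C_def)
    also have "\<dots> < C * d" using d by (simp add: algebra_simps)
    also have "\<dots> = e" using C by (simp add: d_def)
    finally show ?thesis .
  qed
  then show "\<exists>q\<ge>1. \<forall>n\<le>r * q. tdist k ((skew k \<alpha> ^^ n) w) ((skew k \<alpha> ^^ (n + q)) w) < e"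
    unfolding tdist_orbit_gap using q(1) by blast
qed

subsection \<open>Repetition forces good approximation\<close>

text \<open>The rows \<open>f j\<close> behave like polynomials of degree \<open>j\<close> in
  \<open>n\<close> with leading coefficient \<open>d / j!\<close>. Differencing with step
  \<open>q\<close> lowers the degree, multiplies the constant row by \<open>q\<close> and at most
  doubles the bound on the top row; each such step consumes \<open>q\<close> indices, whence
  \<open>(m + 1) * q \<le> L\<close>.\<close>

lemma difference_tower_bound:
  fixes f :: "nat \<Rightarrow> nat \<Rightarrow> real"
  assumes "\<And>j n. j \<le> m \<Longrightarrow> n < L \<Longrightarrow> f (Suc j) (Suc n) = f (Suc j) n + f j n"
    and "\<And>n. n \<le> L \<Longrightarrow> f 0 n = d"
    and "\<And>n. n \<le> L \<Longrightarrow> \<bar>f (Suc m) n\<bar> \<le> e"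
    and "(m + 1) * q \<le> L"
  shows "real q ^ (m + 1) * \<bar>d\<bar> \<le> 2 ^ (m + 1) * e \<and>
         real q ^ m * \<bar>f 1 0\<bar> \<le> real (m + 1) * 2 ^ m * e"
  using assms
proof (induction m arbitrary: f d e L)
  case 0
  have lin: "f 1 n = f 1 0 + real n * d" if "n \<le> L" for n
    using that
  proof (induction n)
    case (Suc n)
    then show ?case using 0(1)[of 0 n] 0(2)[of n] by (simp add: algebra_simps)
  qed simp
  have "q \<le> L" using 0 by simp
  with lin[of q] 0(3)[of q] 0(3)[of 0] have "\<bar>f 1 0\<bar> \<le> e" "\<bar>real q * d\<bar> \<le> 2 * e"
    by auto
  then show ?case by (simp add: abs_mult)
next
  case (Suc m)
  \<comment> \<open>Row \<open>j\<close> of \<open>g\<close> comes from row \<open>j + 1\<close> of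
    \<open>f\<close>, so the induction hypothesis applies with constant row \<open>q * d\<close>,
    bound \<open>2 * e\<close> and length \<open>L - q\<close>.\<close>
  define g where "g j n = f (Suc j) (n + q) - f (Suc j) n" for j n
  note step = Suc.prems(1) and const = Suc.prems(2)
  have qL: "q \<le> L" and qL': "(m + 1) * q \<le> L - q" using Suc.prems(4) by auto
  have lin: "f 1 n = f 1 0 + real n * d" if "n \<le> L" for n
    using that
  proof (induction n)
    case (Suc n)
    then show ?case using step[of 0 n] const[of n] by (simp add: algebra_simps)
  qed simp
  \<comment> \<open>Doubled, so that the coefficient \<open>n (n - 1) / 2\<close> of
    \<open>d\<close> needs no division.\<close>
  have quad: "2 * (f 2 n - f 2 0) = 2 * real n * f 1 0 + real n * (real n - 1) * d" if "n \<le> L" for n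
    using that
  proof (induction n)
    case (Suc n)
    have "f 2 (Suc n) = f 2 n + f 1 n"
      using Suc.prems step[of 1 n] by (simp add: numeral_2_eq_2)
    with Suc lin[of n] show ?case by (simp add: algebra_simps)
  qed simp
  have "real q ^ (m + 1) * \<bar>real q * d\<bar> \<le> 2 ^ (m + 1) * (2 * e) \<and>
        real q ^ m * \<bar>g 1 0\<bar> \<le> real (m + 1) * 2 ^ m * (2 * e)"
  proof (rule Suc.IH[of "L - q"])
    show "g (Suc j) (Suc n) = g (Suc j) n + g j n" if "j \<le> m" "n < L - q" for j n
      using that Suc.prems(1)[of "Suc j" n] Suc.prems(1)[of "Suc j" "n + q"] by (simp add: g_def)
    show "g 0 n = real q * d" if "n \<le> L - q" for n
      using that qL lin[of n] lin[of "n + q"] by (simp add: g_def algebra_simps)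
    show "\<bar>g (Suc m) n\<bar> \<le> 2 * e" if "n \<le> L - q" for n
    proof -
      have "\<bar>f (Suc (Suc m)) n\<bar> \<le> e" "\<bar>f (Suc (Suc m)) (n + q)\<bar> \<le> e"
        using that qL by (auto intro!: Suc.prems(3))
      then show ?thesis unfolding g_def by linarith
    qed
    show "(m + 1) * q \<le> L - q" by (rule qL')
  qed
  then have 1: "real q ^ (m + 2) * \<bar>d\<bar> \<le> 2 ^ (m + 2) * e"
    and 2: "real q ^ m * \<bar>g 1 0\<bar> \<le> real (m + 1) * 2 ^ (m + 1) * e"
    by (simp_all add: abs_mult mult_ac)
  \<comment> \<open>By \<open>quad\<close> this is \<open>q * f 1 0 + q (q - 1) / 2 * d\<close>, so
    the bounds on \<open>g 1 0\<close> and \<open>d\<close> yield one on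
    \<open>f 1 0\<close>.\<close>
  have "g 1 0 = f 2 q - f 2 0" by (simp add: g_def numeral_2_eq_2)
  then have "2 * (real q * f 1 0) = 2 * g 1 0 - real q * (real q - 1) * d"
    using quad[OF qL] by simp
  then have "2 * \<bar>real q * f 1 0\<bar> \<le> 2 * \<bar>g 1 0\<bar> + \<bar>real q * (real q - 1) * d\<bar>"
    by linarith
  moreover have "\<bar>real q * (real q - 1) * d\<bar> \<le> real q * real q * \<bar>d\<bar>"
    unfolding abs_mult by (cases q) (auto intro!: mult_right_mono mult_left_mono)
  ultimately have "2 * \<bar>real q * f 1 0\<bar> \<le> 2 * \<bar>g 1 0\<bar> + real q * real q * \<bar>d\<bar>"
    by linarith
  then have "real q ^ m * (2 * \<bar>real q * f 1 0\<bar>)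
      \<le> real q ^ m * (2 * \<bar>g 1 0\<bar> + real q * real q * \<bar>d\<bar>)"
    by (rule mult_left_mono) simp
  also have "\<dots> = 2 * (real q ^ m * \<bar>g 1 0\<bar>) + real q ^ (m + 2) * \<bar>d\<bar>"
    by (simp add: algebra_simps)
  also have "\<dots> \<le> 2 * (real (m + 1) * 2 ^ (m + 1) * e) + 2 ^ (m + 2) * e"
    using 1 2 by linarith
  finally have "2 * (real q ^ (m + 1) * \<bar>f 1 0\<bar>) \<le> 2 * (real (m + 2) * 2 ^ (m + 1) * e)"
    by (simp add: abs_mult algebra_simps)
  then show ?case using 1 by (simp add: mult_ac)
qed

lemma Ints_abs_less_1_eq_0:
  fixes x :: real
  assumes "x \<in> \<int>" "\<bar>x\<bar> < 1"
  shows "x = 0"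
  using assms by (auto elim!: Ints_cases)

text \<open>The nearest-integer representatives of the gaps stay so small that they obey the same
  recursion exactly, not only mod 1.\<close>

lemma repetition_skewD:
  assumes rep: "repetition k (\<lambda>n. (skew k \<alpha> ^^ n) w)" and k: "k \<ge> 2" and e: "e > 0"
  obtains q where "q \<ge> 1" "real q ^ (k - 1) * tnorm (real q * \<alpha>) < e"
    "real q ^ (k - 2) * tnorm (real q * w 0 + real (q choose 2) * \<alpha>) < e"
proof -
  define C where "C = real k * 2 ^ k"
  have C: "C > 0" using k by (simp add: C_def)
  \<comment> \<open>The value \<open>1/4\<close> keeps sums of up to three representatives below 1
    in absolute value, so that those which are integers vanish; \<open>e / (2 * C)\<close> turns the
    tower bounds into strict bounds by \<open>e\<close>.\<close>
  define d where "d = min (1/4) (e / (2 * C))"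
  have d: "d > 0" "d \<le> 1/4" "C * d < e"
  proof -
    show "d > 0" "d \<le> 1/4" using e C by (auto simp: d_def)
    have "C * d \<le> C * (e / (2 * C))" using C by (intro mult_left_mono) (auto simp: d_def)
    also have "\<dots> < e" using C e by simp
    finally show "C * d < e" .
  qed
  \<comment> \<open>Repetition with \<open>r = k\<close>: a window of length \<open>k * q\<close>
    leaves room for the \<open>k - 1\<close> differences of step \<open>q\<close>.\<close>
  obtain q where q: "q \<ge> 1"
    and close: "\<And>n. n \<le> k * q \<Longrightarrow> (\<Sum>j<k. tnorm (gap \<alpha> w q j n)) < d"
  proof -
    have "1 \<le> k" using k by simp
    then show ?thesis
      using rep d(1) that unfolding repetition_def tdist_orbit_gap by blast
  qed
  have small: "tnorm (gap \<alpha> w q j n) < d" if "j < k" "n \<le> k * q" for j n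
    using member_le_sum[of j "{..<k}" "\<lambda>j. tnorm (gap \<alpha> w q j n)"] close[of n] that
    by (auto simp: tnorm_nonneg)
  define p where "p j n = (SOME p :: int. tnorm (gap \<alpha> w q j n) = \<bar>gap \<alpha> w q j n - of_int p\<bar>)" for j n
  have p: "tnorm (gap \<alpha> w q j n) = \<bar>gap \<alpha> w q j n - of_int (p j n)\<bar>" for j n
    unfolding p_def by (rule someI_ex) (metis tnorm_eq_dist)
  define f where "f j n = gap \<alpha> w q j n - of_int (p j n)" for j n
  have f: "\<bar>f j n\<bar> < d" if "j < k" "n \<le> k * q" for j n
    using small[OF that] by (simp add: f_def p)
  have rec: "f (Suc j) (Suc n) = f (Suc j) n + f j n" if "Suc j < k" "n < k * q" for j n
  proof -
    have "f (Suc j) (Suc n) - f (Suc j) n - f j n = 0"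
    proof (rule Ints_abs_less_1_eq_0)
      show "f (Suc j) (Suc n) - f (Suc j) n - f j n \<in> \<int>"
        by (simp add: f_def gap_Suc)
      show "\<bar>f (Suc j) (Suc n) - f (Suc j) n - f j n\<bar> < 1"
        using f[of "Suc j" "Suc n"] f[of "Suc j" n] f[of j n] that d(2) by auto
    qed
    then show ?thesis by simp
  qed
  have const: "f 0 n = f 0 0" if "n \<le> k * q" for n
  proof -
    have "f 0 n - f 0 0 = 0"
    proof (rule Ints_abs_less_1_eq_0)
      show "f 0 n - f 0 0 \<in> \<int>" by (simp add: f_def gap_0)
      show "\<bar>f 0 n - f 0 0\<bar> < 1" using f[of 0 n] f[of 0 0] that d(2) k by auto
    qed
    then show ?thesis by simp
  qed
  obtain m where m: "k = m + 2" using k by (metis add.commute le_Suc_ex)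
  have "real q ^ (m + 1) * \<bar>f 0 0\<bar> \<le> 2 ^ (m + 1) * d \<and>
        real q ^ m * \<bar>f 1 0\<bar> \<le> real (m + 1) * 2 ^ m * d"
  proof (rule difference_tower_bound[where L = "k * q"])
    show "\<And>j n. j \<le> m \<Longrightarrow> n < k * q \<Longrightarrow> f (Suc j) (Suc n) = f (Suc j) n + f j n"
      using rec by (simp add: m)
    show "\<And>n. n \<le> k * q \<Longrightarrow> f 0 n = f 0 0" by (rule const)
    show "\<And>n. n \<le> k * q \<Longrightarrow> \<bar>f (Suc m) n\<bar> \<le> d" using f[of "Suc m"] by (simp add: m less_imp_le)
    show "(m + 1) * q \<le> k * q" by (simp add: m)
  qed
  moreover have "2 ^ (m + 1) * d \<le> C * d" "real (m + 1) * 2 ^ m * d \<le> C * d"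
  proof -
    have "(1::real) * 2 ^ (m + 1) \<le> C" "real (m + 1) * 2 ^ m \<le> C"
      unfolding C_def m by (intro mult_mono power_increasing; simp)+
    then show "2 ^ (m + 1) * d \<le> C * d" "real (m + 1) * 2 ^ m * d \<le> C * d"
      using d(1) by (intro mult_right_mono; simp)+
  qed
  moreover have "\<bar>f 0 0\<bar> = tnorm (real q * \<alpha>)"
    "\<bar>f 1 0\<bar> = tnorm (real q * w 0 + real (q choose 2) * \<alpha>)"
    using p[of 0 0] p[of 1 0] by (simp_all add: f_def gap_0 gap_1 del: One_nat_def)
  ultimately show ?thesis using d(3) q by (intro that[of q]) (auto simp: m)
qed

text \<open>For irrational \<alpha> the finitely many values \<open>tnorm (q * \<alpha>)\<close>
  with \<open>1 \<le> q \<le> N\<close> have a positive minimum; asking for accuracy below it forces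
  \<open>q > N\<close>.\<close>

lemma PRP_approx:
  assumes w: "w \<in> PRP k \<alpha>" and k: "k \<ge> 2" and irr: "\<alpha> \<notin> \<rat>" and e: "e > 0"
  obtains q where "q \<ge> N" "q \<ge> 1" "real q ^ (k - 1) * tnorm (real q * \<alpha>) < e"
    "real q ^ (k - 2) * tnorm (real q * w 0 + real (q choose 2) * \<alpha>) < e"
proof -
  define d where "d = Min (insert e ((\<lambda>q. tnorm (real q * \<alpha>)) ` {1..N}))"
  have d: "d > 0" "d \<le> e"
    using e tnorm_nat_mult_pos[OF irr] by (simp_all add: d_def)
  have d_le: "d \<le> tnorm (real q * \<alpha>)" if "q \<in> {1..N}" for q
    unfolding d_def using that by (intro Min_le) auto
  have rep: "repetition k (\<lambda>n. (skew k \<alpha> ^^ n) w)" using w by (simp add: PRP_def)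
  obtain q where q: "q \<ge> 1" "real q ^ (k - 1) * tnorm (real q * \<alpha>) < d"
    "real q ^ (k - 2) * tnorm (real q * w 0 + real (q choose 2) * \<alpha>) < d"
    using repetition_skewD[OF rep k d(1)] by blast
  have "1 * tnorm (real q * \<alpha>) \<le> real q ^ (k - 1) * tnorm (real q * \<alpha>)"
    using q(1) by (intro mult_right_mono tnorm_nonneg) simp
  then have "q \<notin> {1..N}" using d_le[of q] q(2) by linarith
  then show ?thesis using q d(2) by (intro that[of q]) auto
qed

subsection \<open>Topological and global repetition\<close>

lemma liminf_ereal_eq_0_iff:
  fixes a :: "nat \<Rightarrow> real"
  assumes "\<And>n. 0 \<le> a n"
  shows "liminf (\<lambda>n. ereal (a n)) = 0 \<longleftrightarrow> (\<forall>e>0. \<forall>N. \<exists>n\<ge>N. a n < e)"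
proof
  assume lim: "liminf (\<lambda>n. ereal (a n)) = 0"
  show "\<forall>e>0. \<forall>N. \<exists>n\<ge>N. a n < e"
  proof (intro allI impI, rule ccontr)
    fix e :: real and N
    assume "e > 0" "\<not> (\<exists>n\<ge>N. a n < e)"
    then have "\<forall>n\<ge>N. ereal e \<le> ereal (a n)" by auto
    then have "ereal e \<le> liminf (\<lambda>n. ereal (a n))"
      by (intro Liminf_bounded) (auto simp: eventually_sequentially)
    then show False using \<open>e > 0\<close> lim by simp
  qed
next
  assume small: "\<forall>e>0. \<forall>N. \<exists>n\<ge>N. a n < e"
  show "liminf (\<lambda>n. ereal (a n)) = 0"
  proof (rule ccontr)
    assume "liminf (\<lambda>n. ereal (a n)) \<noteq> 0"
    moreover have "0 \<le> liminf (\<lambda>n. ereal (a n))"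
      using assms by (intro Liminf_bounded) auto
    ultimately have "0 < liminf (\<lambda>n. ereal (a n))" by auto
    then obtain e :: real where e: "0 < ereal e" "ereal e < liminf (\<lambda>n. ereal (a n))"
      using ereal_dense2 by blast
    from less_LiminfD[OF e(2)] obtain N where N: "\<forall>n\<ge>N. e < a n"
      by (auto simp: eventually_sequentially)
    from small e(1) obtain n where "n \<ge> N" "a n < e" by auto
    with N show False by force
  qed
qed

lemma PRP_approx_liminf:
  assumes "w \<in> PRP k \<alpha>" "k \<ge> 2" "\<alpha> \<notin> \<rat>"
  shows "liminf (\<lambda>q. ereal (real q ^ (k - 1) * tnorm (real q * \<alpha>))) = 0"
  unfolding liminf_ereal_eq_0_iff[OF mult_nonneg_nonneg[OF zero_le_power[OF of_nat_0_le_iff] tnorm_nonneg]]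
  using PRP_approx[OF assms] by metis

text \<open>For \<open>q = k! p\<close> the absorption identity
  \<open>(j + 1) (q choose (j + 1)) = q (q - 1 choose j)\<close> shows that every binomial
  coefficient involved is a multiple of \<open>p\<close>. Each gap of the zero orbit is then a
  multiple of \<open>p * \<alpha>\<close> by a factor of order \<open>q ^ j\<close>.\<close>

lemma zero_PRP:
  assumes k: "k \<ge> 2"
    and small: "\<And>e. e > 0 \<Longrightarrow> \<exists>q\<ge>1. real q ^ (k - 1) * tnorm (real q * \<alpha>) < e"
  shows "(\<lambda>j\<in>{..<k}. 0) \<in> PRP k \<alpha>"
proof -
  define w where "w = (\<lambda>j\<in>{..<k}. 0 :: real)"
  have "repetition k (\<lambda>n. (skew k \<alpha> ^^ n) w)"
  proof (rule repetition_skewI)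
    fix e :: real assume "e > 0"
    \<comment> \<open>One factor \<open>k!\<close> comes from the bound on \<open>c\<close> and
      \<open>k - 1\<close> more from \<open>q ^ (k - 1)\<close>; \<open>C\<close> dominates their
      product.\<close>
    define C where "C = real (fact k) ^ (k + 1)"
    have C: "C > 0" by (simp add: C_def)
    with \<open>e > 0\<close> have "e / C > 0" by simp
    with small obtain p where p: "p \<ge> 1" "real p ^ (k - 1) * tnorm (real p * \<alpha>) < e / C" by blast
    define q where "q = fact k * p"
    have "real q ^ (k - 1 - j) * tnorm (gap \<alpha> w q j 0) \<le> e" if j: "j < k" for j
    proof -
      obtain c where c: "fact k = Suc j * c"
        using dvd_fact[of "Suc j" k] j by (auto simp: dvd_def)
      have "Suc j * (q choose Suc j) = q * (q - 1 choose j)"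
        by (rule binomial_absorption)
      also have "\<dots> = Suc j * (c * (q - 1 choose j) * p)"
        by (simp add: q_def c del: mult_Suc)
      finally have "q choose Suc j = c * (q - 1 choose j) * p" by (simp del: mult_Suc)
      then have "gap \<alpha> w q j 0 = real (c * (q - 1 choose j)) * (real p * \<alpha>)"
        using j by (subst gap_zero) (auto simp: w_def)
      then have "tnorm (gap \<alpha> w q j 0) \<le> real (c * (q - 1 choose j)) * tnorm (real p * \<alpha>)"
        using tnorm_nat_mult by metis
      also have "\<dots> \<le> real (fact k * q ^ j) * tnorm (real p * \<alpha>)"
      proof (intro mult_right_mono tnorm_nonneg of_nat_mono mult_mono)
        show "c \<le> fact k" unfolding c by simp
        have "(q - 1 choose j) \<le> (q - 1) ^ j"
        proof (cases "j \<le> q - 1")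
          case True
          then show ?thesis by (rule binomial_le_pow)
        qed (simp add: binomial_eq_0)
        also have "\<dots> \<le> q ^ j" by (intro power_mono) auto
        finally show "(q - 1 choose j) \<le> q ^ j" .
      qed auto
      finally have "real q ^ (k - 1 - j) * tnorm (gap \<alpha> w q j 0)
          \<le> real q ^ (k - 1 - j) * (real (fact k * q ^ j) * tnorm (real p * \<alpha>))"
        by (intro mult_left_mono) auto
      also have "\<dots> = real (fact k) * (real q ^ (k - 1 - j) * real q ^ j) * tnorm (real p * \<alpha>)"
        by simp
      also have "real q ^ (k - 1 - j) * real q ^ j = real q ^ (k - 1)"
        using j by (simp flip: power_add)
      also have "real (fact k) * real q ^ (k - 1) * tnorm (real p * \<alpha>)
          = real (fact k) ^ Suc (k - 1) * (real p ^ (k - 1) * tnorm (real p * \<alpha>))"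
        by (simp add: q_def power_mult_distrib)
      also have "\<dots> \<le> C * (real p ^ (k - 1) * tnorm (real p * \<alpha>))"
        unfolding C_def using fact_ge_1[of k, where ?'a = real]
        by (intro mult_right_mono power_increasing mult_nonneg_nonneg tnorm_nonneg) auto
      also have "\<dots> \<le> e" using p(2) C by (simp add: field_simps)
      finally show ?thesis .
    qed
    moreover have "q \<ge> 1" using p(1) by (simp add: q_def Suc_le_eq)
    ultimately show "\<exists>q\<ge>1. \<forall>j<k. real q ^ (k - 1 - j) * tnorm (gap \<alpha> w q j 0) \<le> e" by blast
  qed
  moreover have "w \<in> torus k" by (auto simp: w_def torus_def)
  ultimately show ?thesis by (simp add: PRP_def w_def)
qed

lemma TRP_iff_liminf:
  assumes "\<alpha> \<notin> \<rat>" "k \<ge> 2"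
  shows "TRP k \<alpha> \<longleftrightarrow> liminf (\<lambda>q. ereal (real q ^ (k - 1) * tnorm (real q * \<alpha>))) = 0"
proof
  assume "TRP k \<alpha>"
  then show "liminf (\<lambda>q. ereal (real q ^ (k - 1) * tnorm (real q * \<alpha>))) = 0"
    using PRP_approx_liminf assms by (auto simp: TRP_def)
next
  assume "liminf (\<lambda>q. ereal (real q ^ (k - 1) * tnorm (real q * \<alpha>))) = 0"
  then have "\<forall>e>0. \<forall>N. \<exists>q\<ge>N. real q ^ (k - 1) * tnorm (real q * \<alpha>) < e"
    by (subst (asm) liminf_ereal_eq_0_iff) (simp_all add: tnorm_nonneg)
  then have "(\<lambda>j\<in>{..<k}. 0) \<in> PRP k \<alpha>"
    using assms(2) by (intro zero_PRP) blast+
  then show "TRP k \<alpha>" by (auto simp: TRP_def)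
qed

text \<open>Both gaps at period \<open>q = 2 m p\<close> are integer combinations of
  \<open>p * \<alpha>\<close> and \<open>p * w 0\<close>. The hypothesis controls the former; the
  latter, for arbitrary \<open>w 0\<close>, is made small by the Dirichlet multiplier
  \<open>m\<close>.\<close>

lemma PRP_2_eq_torus:
  assumes small: "\<And>e. e > 0 \<Longrightarrow> \<exists>q\<ge>1. real q * tnorm (real q * \<alpha>) < e"
  shows "PRP 2 \<alpha> = torus 2"
proof -
  have "repetition 2 (\<lambda>n. (skew 2 \<alpha> ^^ n) w)" for w
  proof (rule repetition_skewI)
    fix e :: real assume e: "e > 0"
    \<comment> \<open>\<open>M\<close> is fixed before \<open>p\<close>: it makes the Dirichlet
      error \<open>2 / M\<close> at most \<open>e / 2\<close>, and the accuracy \<open>d\<close>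
      demanded of \<open>p\<close> can then absorb the factor
      \<open>m ^ 2 \<le> M ^ 2\<close>.\<close>
    obtain M :: nat where M: "M \<ge> 1" "4 / e \<le> real M"
      using real_arch_simple[of "max 1 (4 / e)"] by auto
    define d where "d = e / (8 * real M ^ 2)"
    have "d > 0" using e M(1) by (simp add: d_def)
    with small obtain p where p: "p \<ge> 1" "real p * tnorm (real p * \<alpha>) < d" by blast
    obtain m where m: "1 \<le> m" "m \<le> M" "tnorm (real m * (real p * w 0)) < 1 / real M"
      using Dirichlet_tnorm[OF M(1)] by blast
    \<comment> \<open>The factor 2 makes \<open>q choose 2\<close> a multiple of
      \<open>p\<close>.\<close>
    define q where "q = 2 * m * p"
    have choose: "q choose 2 = m * (q - 1) * p"
      by (simp add: choose_two q_def)
    have "real q ^ (2 - 1 - j) * tnorm (gap \<alpha> w q j 0) \<le> e" if j: "j < 2" for j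
    proof -
      have "real m ^ 2 \<le> real M ^ 2" using m(2) by (intro power_mono) auto
      then have "(8 * real m ^ 2) * d \<le> (8 * real M ^ 2) * d"
        using \<open>d > 0\<close> by (intro mult_right_mono) auto
      also have "\<dots> = e" using M(1) by (simp add: d_def)
      finally have bound: "8 * (real m ^ 2 * (real p * tnorm (real p * \<alpha>))) \<le> e"
        using mult_left_mono[OF less_imp_le[OF p(2)], of "real m ^ 2"] by simp
      consider "j = 0" | "j = 1" using j by linarith
      then show ?thesis
      proof cases
        case 1
        have "tnorm (real q * \<alpha>) \<le> real (2 * m) * tnorm (real p * \<alpha>)"
          using tnorm_nat_mult[of "2 * m" "real p * \<alpha>"] by (simp add: q_def mult.assoc)
        then have "real q * tnorm (real q * \<alpha>) \<le> real q * (real (2 * m) * tnorm (real p * \<alpha>))"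
          by (rule mult_left_mono) simp
        also have "\<dots> = 4 * (real m ^ 2 * (real p * tnorm (real p * \<alpha>)))"
          by (simp add: q_def power2_eq_square)
        also have "\<dots> \<le> e" using bound e by linarith
        finally show ?thesis using 1 by (simp add: gap_0)
      next
        case 2
        have "gap \<alpha> w q 1 0 = real 2 * (real m * (real p * w 0)) + real (m * (q - 1)) * (real p * \<alpha>)"
          unfolding gap_1 choose by (simp add: q_def)
        then have "tnorm (gap \<alpha> w q 1 0) \<le> real 2 * tnorm (real m * (real p * w 0))
            + real (m * (q - 1)) * tnorm (real p * \<alpha>)"
          by (simp only:) (rule order_trans[OF tnorm_add], intro add_mono tnorm_nat_mult)
        also have "\<dots> \<le> 2 * (1 / real M) + real (m * q) * tnorm (real p * \<alpha>)"
          using m(3) by (intro add_mono mult_right_mono tnorm_nonneg of_nat_mono mult_le_mono) auto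
        also have "2 * (1 / real M) \<le> e / 2" using M e by (simp add: field_simps)
        also have "real (m * q) * tnorm (real p * \<alpha>) = 2 * (real m ^ 2 * (real p * tnorm (real p * \<alpha>)))"
          by (simp add: q_def power2_eq_square)
        finally show ?thesis using 2 bound e by simp
      qed
    qed
    moreover have "q \<ge> 1" using p(1) m(1) by (simp add: q_def Suc_le_eq)
    ultimately show "\<exists>q\<ge>1. \<forall>j<2. real q ^ (2 - 1 - j) * tnorm (gap \<alpha> w q j 0) \<le> e" by blast
  qed
  then show ?thesis by (auto simp: PRP_def)
qed

section \<open>Failure of global repetition through the first coordinate
  \<open>sqrt 2\<close>\<close>

lemma square_eq_2_square:
  fixes p q :: nat
  assumes "p\<^sup>2 = 2 * q\<^sup>2"
  shows "q = 0"
  using assms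
proof (induction p arbitrary: q rule: less_induct)
  case (less p)
  have "even (p\<^sup>2)" using less.prems by simp
  \<comment> \<open>Infinite descent: the pair \<open>(p, q)\<close> is replaced by
    \<open>(q, r)\<close>.\<close>
  then obtain r where r: "p = 2 * r" by auto
  show ?case
  proof (rule ccontr)
    assume "q \<noteq> 0"
    then have "q\<^sup>2 < p\<^sup>2" using less.prems by simp
    then have "q < p" by (rule power_less_imp_less_base) simp
    moreover have "q\<^sup>2 = 2 * r\<^sup>2" using less.prems r by simp
    ultimately have "r = 0" by (rule less.IH)
    then show False using less.prems r \<open>q \<noteq> 0\<close> by simp
  qed
qed

text \<open>Liouville's argument: with \<open>p\<close> the nearest integer to
  \<open>x = q * sqrt 2\<close>, the product \<open>(x - p) (x + p) = 2 q ^ 2 - p ^ 2\<close> is a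
  nonzero integer, while the second factor is at most \<open>4 * q\<close> in absolute
  value.\<close>

lemma tnorm_sqrt_2:
  assumes "q \<ge> 1"
  shows "1/4 \<le> real q * tnorm (real q * sqrt 2)"
proof -
  obtain p :: int where p: "tnorm (real q * sqrt 2) = \<bar>real q * sqrt 2 - of_int p\<bar>"
    using tnorm_eq_dist by metis
  let ?x = "real q * sqrt 2"
  have half: "\<bar>?x - of_int p\<bar> \<le> 1/2"
    unfolding p[symmetric] tnorm_def by (simp add: min_def)
  have "(?x - of_int p) * (?x + of_int p) = ?x\<^sup>2 - (of_int p)\<^sup>2"
    by (simp add: power2_eq_square algebra_simps)
  also have "\<dots> = of_int (2 * (int q)\<^sup>2 - p\<^sup>2)" by (simp add: power_mult_distrib)
  finally have prod: "(?x - of_int p) * (?x + of_int p) = of_int (2 * (int q)\<^sup>2 - p\<^sup>2)" .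
  have "(nat \<bar>p\<bar>)\<^sup>2 \<noteq> 2 * q\<^sup>2" using square_eq_2_square assms by fastforce
  then have "int ((nat \<bar>p\<bar>)\<^sup>2) \<noteq> int (2 * q\<^sup>2)" by (simp only: of_nat_eq_iff not_False_eq_True)
  then have "2 * (int q)\<^sup>2 - p\<^sup>2 \<noteq> 0" by simp
  then have "1 \<le> \<bar>?x - of_int p\<bar> * \<bar>?x + of_int p\<bar>"
    unfolding abs_mult[symmetric] prod by linarith
  also have "\<bar>?x + of_int p\<bar> \<le> 4 * real q"
  proof -
    have "sqrt 2 \<le> 3/2" by (rule real_le_lsqrt) (auto simp: power2_eq_square)
    then have "?x \<le> real q * (3/2)" by (intro mult_left_mono) auto
    moreover have "0 \<le> ?x" by simp
    ultimately show ?thesis using half assms by linarith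
  qed
  finally have "1 \<le> \<bar>?x - of_int p\<bar> * (4 * real q)" by (simp add: mult_left_mono)
  then show ?thesis by (simp add: p mult_ac)
qed

text \<open>Twice the gap of index 1 is \<open>2 q w\<^sub>0 + q (q - 1) \<alpha>\<close>. For
  \<open>k \<ge> 3\<close> the weights of \<open>PRP_approx\<close> suffice to remove the
  \<alpha>-term, so repetition would approximate \<open>sqrt 2\<close> too well by fractions with
  denominator \<open>2 * q\<close>.\<close>

lemma PRP_ne_torus:
  assumes "\<alpha> \<notin> \<rat>" "k \<ge> 3"
  shows "PRP k \<alpha> \<noteq> torus k"
proof
  assume eq: "PRP k \<alpha> = torus k"
  define w where "w = (\<lambda>j\<in>{..<k}. frac (sqrt 2))"
  have "w \<in> torus k" by (auto simp: w_def torus_def frac_lt_1)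
  then have w: "w \<in> PRP k \<alpha>" by (simp add: eq)
  let ?s = "\<lambda>q. tnorm (real q * \<alpha>)" and ?t = "\<lambda>q. tnorm (real q * w 0 + real (q choose 2) * \<alpha>)"
  \<comment> \<open>With \<open>1/24\<close> the final estimate is
    \<open>4 * (1/24) + 2 * (1/24) = 1/4\<close>, the constant of
    \<open>tnorm_sqrt_2\<close>.\<close>
  obtain q where q: "q \<ge> 1" "real q ^ (k - 1) * ?s q < 1/24" "real q ^ (k - 2) * ?t q < 1/24"
    using PRP_approx[OF w _ assms(1), of "1/24"] assms(2) by auto
  have "real q ^ 2 * ?s q \<le> real q ^ (k - 1) * ?s q" "real q ^ 1 * ?t q \<le> real q ^ (k - 2) * ?t q"
    using q(1) assms(2) by (intro mult_right_mono power_increasing tnorm_nonneg; simp)+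
  with q have bounds: "real q ^ 2 * ?s q < 1/24" "real q * ?t q < 1/24" by auto
  have "2 * (q choose 2) = q * (q - 1)"
    using binomial_absorption[of 1 q] by (simp add: numeral_2_eq_2)
  then have choose: "2 * real (q choose 2) = real q * real (q - 1)"
    by (metis of_nat_mult of_nat_numeral)
  have "real (2 * q) * sqrt 2 - real (2 * q) * w 0 = real (2 * q) * (sqrt 2 - frac (sqrt 2))"
    using assms(2) by (simp add: w_def algebra_simps)
  also have "\<dots> \<in> \<int>" by (simp add: frac_def)
  finally have "tnorm (real (2 * q) * sqrt 2) = tnorm (real (2 * q) * w 0)" by (rule tnorm_cong)
  also have "real (2 * q) * w 0 = real 2 * (real q * w 0 + real (q choose 2) * \<alpha>) + - (real (q - 1) * (real q * \<alpha>))"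
  proof -
    have "real 2 * (real q * w 0 + real (q choose 2) * \<alpha>) = real (2 * q) * w 0 + (2 * real (q choose 2)) * \<alpha>"
      by (simp add: algebra_simps)
    then show ?thesis by (simp only: choose) (simp add: mult.assoc)
  qed
  also have "tnorm \<dots> \<le> real 2 * ?t q + real (q - 1) * ?s q"
    by (rule order_trans[OF tnorm_add], unfold tnorm_minus) (intro add_mono tnorm_nat_mult)
  also have "\<dots> \<le> 2 * ?t q + real q * ?s q"
    using tnorm_nonneg by (intro add_mono mult_right_mono) auto
  finally have "real (2 * q) * tnorm (real (2 * q) * sqrt 2) \<le> real (2 * q) * (2 * ?t q + real q * ?s q)"
    by (rule mult_left_mono) simp
  also have "\<dots> = 4 * (real q * ?t q) + 2 * (real q ^ 2 * ?s q)"
    by (simp add: power2_eq_square algebra_simps)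
  also have "\<dots> < 1/4" using bounds by linarith
  finally show False using tnorm_sqrt_2[of "2 * q"] q(1) by simp
qed

subsection \<open>Metric statements\<close>

text \<open>Borel-Cantelli: within \<open>{- N..N}\<close> the exceptional set for \<open>q\<close>
  lies in O(q) intervals of length \<open>2 / q ^ 3\<close>, so its measure is
  O(\<open>1 / q ^ 2\<close>), which is summable. The shifts \<open>b q\<close> allow use both for
  \<alpha> itself and for the first coordinate of a point.\<close>

lemma AE_eventually_tnorm_ge:
  fixes b :: "nat \<Rightarrow> real"
  shows "AE x in lborel. \<forall>\<^sub>F q in sequentially. 1 \<le> real q ^ 2 * tnorm (real q * x + b q)"
proof -
  have "AE x in lborel. \<bar>x\<bar> \<le> real N \<longrightarrow>
      (\<forall>\<^sub>F q in sequentially. 1 \<le> real q ^ 2 * tnorm (real q * x + b q))" for N :: nat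
  proof -
    define A where "A q = {x \<in> {- real N..real N}. real q ^ 2 * tnorm (real q * x + b q) < 1}" for q
    have A [measurable]: "A q \<in> sets lborel" for q
      unfolding A_def by measurable
    have fin: "emeasure lborel (A q) < \<infinity>" for q
    proof -
      have "emeasure lborel (A q) \<le> emeasure lborel {- real N..real N}"
        by (intro emeasure_mono) (auto simp: A_def)
      also have "\<dots> < \<infinity>" by simp
      finally show ?thesis .
    qed
    have bound: "measure lborel (A q) \<le> 2 * (2 * real N + 6) * inverse (real q ^ 2)" if q: "q \<ge> 1" for q
    proof -
      \<comment> \<open>\<open>P\<close> contains every integer within distance 1 of some
        \<open>q * x + b q\<close> with \<open>x\<close> in \<open>{- N..N}\<close>;
        \<open>B p\<close> is the set of \<open>x\<close> for which \<open>p\<close> is within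
        \<open>1 / q ^ 2\<close>.\<close>
      define P where "P = {\<lfloor>b q - real q * real N\<rfloor> - 1..\<lfloor>b q + real q * real N\<rfloor> + 2}"
      define B where "B p = {(of_int p - b q) / real q - 1 / real q ^ 3..(of_int p - b q) / real q + 1 / real q ^ 3}"
        for p :: int
      have sub: "A q \<subseteq> (\<Union>p\<in>P. B p)"
      proof
        fix x assume x: "x \<in> A q"
        obtain p :: int where p: "tnorm (real q * x + b q) = \<bar>real q * x + b q - of_int p\<bar>"
          using tnorm_eq_dist by metis
        have lt: "real q ^ 2 * \<bar>real q * x + b q - of_int p\<bar> < 1" using x by (simp add: A_def p)
        have "1 * \<bar>real q * x + b q - of_int p\<bar> \<le> real q ^ 2 * \<bar>real q * x + b q - of_int p\<bar>"
          using q by (intro mult_right_mono) auto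
        also note lt
        finally have near: "\<bar>real q * x + b q - of_int p\<bar> < 1" by simp
        have "\<bar>real q * x\<bar> \<le> real q * real N"
          using x by (auto simp: A_def abs_mult intro!: mult_left_mono)
        with near have "p \<in> P" unfolding P_def by (simp add: abs_le_iff abs_less_iff) linarith
        moreover have "\<bar>x - (of_int p - b q) / real q\<bar> \<le> 1 / real q ^ 3"
        proof -
          have "real q ^ 3 * \<bar>x - (of_int p - b q) / real q\<bar>
              = real q ^ 2 * \<bar>real q * (x - (of_int p - b q) / real q)\<bar>"
            by (simp add: abs_mult power2_eq_square power3_eq_cube)
          also have "real q * (x - (of_int p - b q) / real q) = real q * x + b q - of_int p"
            using q by (simp add: field_simps)
          finally have "\<bar>x - (of_int p - b q) / real q\<bar> * real q ^ 3 \<le> 1"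
            using lt by (simp add: mult.commute)
          then show ?thesis using q by (subst pos_le_divide_eq) auto
        qed
        then have "x \<in> B p" unfolding B_def by (auto simp: abs_le_iff)
        ultimately show "x \<in> (\<Union>p\<in>P. B p)" by blast
      qed
      have "measure lborel (A q) \<le> measure lborel (\<Union>p\<in>P. B p)"
        by (intro measure_mono_fmeasurable sub A fmeasurable.finite_UN)
           (auto simp: P_def B_def fmeasurable_def)
      also have "\<dots> \<le> (\<Sum>p\<in>P. measure lborel (B p))"
        by (rule measure_UNION_le) (auto simp: P_def B_def)
      also have "\<dots> = real (card P) * (2 / real q ^ 3)"
        by (simp add: B_def)
      also have "\<dots> \<le> real q * (2 * real N + 6) * (2 / real q ^ 3)"
      proof (rule mult_right_mono)
        have "real (card P) = of_int (\<lfloor>b q + real q * real N\<rfloor> - \<lfloor>b q - real q * real N\<rfloor> + 4)"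
        proof -
          have "b q - real q * real N \<le> b q + real q * real N" by simp
          then have "\<lfloor>b q - real q * real N\<rfloor> \<le> \<lfloor>b q + real q * real N\<rfloor>" by (rule floor_mono)
          then show ?thesis unfolding P_def card_atLeastAtMost_int by linarith
        qed
        also have "\<dots> \<le> 2 * (real q * real N) + 6" by linarith
        also have "\<dots> \<le> real q * (2 * real N + 6)" using q by (simp add: algebra_simps)
        finally show "real (card P) \<le> real q * (2 * real N + 6)" .
      qed simp
      also have "\<dots> = 2 * (2 * real N + 6) * inverse (real q ^ 2)"
        using q by (simp add: field_simps power2_eq_square power3_eq_cube)
      finally show ?thesis .
    qed
    have "summable (\<lambda>q. measure lborel (A q))"
    proof (rule summable_comparison_test)
      show "summable (\<lambda>q. 2 * (2 * real N + 6) * inverse (real q ^ 2))"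
        by (intro summable_mult inverse_power_summable) simp
      show "\<exists>N'. \<forall>q\<ge>N'. norm (measure lborel (A q)) \<le> 2 * (2 * real N + 6) * inverse (real q ^ 2)"
        using bound by (auto intro!: exI[of _ 1])
    qed
    from borel_cantelli_AE1[OF A fin this]
    show ?thesis
    proof eventually_elim
      case (elim x)
      show ?case
      proof
        assume "\<bar>x\<bar> \<le> real N"
        with elim show "\<forall>\<^sub>F q in sequentially. 1 \<le> real q ^ 2 * tnorm (real q * x + b q)"
          by (auto elim!: eventually_mono simp: A_def not_less)
      qed
    qed
  qed
  then have "AE x in lborel. \<forall>N :: nat. \<bar>x\<bar> \<le> real N \<longrightarrow>
      (\<forall>\<^sub>F q in sequentially. 1 \<le> real q ^ 2 * tnorm (real q * x + b q))"
    unfolding AE_all_countable by blast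
  then show ?thesis
    by eventually_elim (use real_arch_simple in blast)
qed

lemma AE_not_TRP:
  assumes "k \<ge> 3"
  shows "AE \<alpha> in lborel. \<alpha> \<notin> \<rat> \<longrightarrow> \<not> TRP k \<alpha>"
  using AE_eventually_tnorm_ge[of "\<lambda>_. 0"]
proof eventually_elim
  case (elim \<alpha>)
  then obtain N where N: "\<And>q. q \<ge> N \<Longrightarrow> 1 \<le> real q ^ 2 * tnorm (real q * \<alpha>)"
    by (auto simp: eventually_sequentially)
  show ?case
  proof (intro impI notI)
    assume "\<alpha> \<notin> \<rat>" "TRP k \<alpha>"
    then obtain w where "w \<in> PRP k \<alpha>" by (auto simp: TRP_def)
    then obtain q where q: "q \<ge> N" "q \<ge> 1" "real q ^ (k - 1) * tnorm (real q * \<alpha>) < 1"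
      using PRP_approx[of w k \<alpha> 1 N] assms \<open>\<alpha> \<notin> \<rat>\<close> by auto
    have "real q ^ 2 * tnorm (real q * \<alpha>) \<le> real q ^ (k - 1) * tnorm (real q * \<alpha>)"
      using q assms by (intro mult_right_mono power_increasing tnorm_nonneg) auto
    then show False using N[OF q(1)] q(3) by linarith
  qed
qed

section \<open>Positive and zero measure through boxes in the product space\<close>

interpretation lborel_family: product_sigma_finite "\<lambda>_ :: nat. lborel :: real measure"
  by standard

text \<open>Since \<open>MRP\<close> means not being null in the completion, a measurable box of
  positive measure inside \<open>PRP\<close> suffices, whether or not \<open>PRP\<close> itself is
  measurable.\<close>

lemma MRP_I:
  assumes "PiE {..<k} A \<subseteq> PRP k \<alpha>"
    and "\<And>j. j < k \<Longrightarrow> A j \<in> sets borel" "\<And>j. j < k \<Longrightarrow> emeasure lborel (A j) \<noteq> 0"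
  shows "MRP k \<alpha>"
  unfolding MRP_def
proof
  let ?M = "PiM {..<k} (\<lambda>_. lborel) :: (nat \<Rightarrow> real) measure"
  assume "PRP k \<alpha> \<in> null_sets (completion ?M)"
  then have "PiE {..<k} A \<in> null_sets (completion ?M)"
    using assms(1) by (blast intro: null_sets_completion_subset)
  moreover have "PiE {..<k} A \<in> sets ?M"
    using assms(2) by (intro sets_PiM_I_finite) auto
  ultimately have "emeasure ?M (PiE {..<k} A) = 0"
    by (simp add: null_sets_completion_iff null_sets_def)
  moreover have "emeasure ?M (PiE {..<k} A) = (\<Prod>j<k. emeasure lborel (A j))"
    using assms(2) by (intro lborel_family.emeasure_PiM) auto
  ultimately show False using assms(3) by (auto simp: prod_zero_iff)
qed

text \<open>For \<open>k \<ge> 4\<close> the weight \<open>q ^ (k - 2)\<close> is at least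
  \<open>q ^ 2\<close>, so \<open>AE_eventually_tnorm_ge\<close> with shifts
  \<open>(q choose 2) * \<alpha>\<close> confines \<open>w 0\<close> to a null set \<open>N\<close>,
  and \<open>PRP\<close> to the cylinder over \<open>N\<close>.\<close>

lemma not_MRP:
  assumes irr: "\<alpha> \<notin> \<rat>" and k: "k \<ge> 4"
  shows "\<not> MRP k \<alpha>"
proof -
  let ?M = "PiM {..<k} (\<lambda>_. lborel) :: (nat \<Rightarrow> real) measure"
  let ?P = "\<lambda>x. \<forall>\<^sub>F q in sequentially. 1 \<le> real q ^ 2 * tnorm (real q * x + real (q choose 2) * \<alpha>)"
  obtain N where N: "N \<in> null_sets lborel" "{x. \<not> ?P x} \<subseteq> N"
    using AE_eventually_tnorm_ge[of "\<lambda>q. real (q choose 2) * \<alpha>"]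
    by (auto simp: eventually_ae_filter)
  let ?A = "\<lambda>j. if j = 0 then N else UNIV :: real set"
  have "PRP k \<alpha> \<subseteq> PiE {..<k} ?A"
  proof
    fix w assume w: "w \<in> PRP k \<alpha>"
    have "\<not> ?P (w 0)"
    proof
      assume "?P (w 0)"
      then obtain n where n: "\<And>q. q \<ge> n \<Longrightarrow>
          1 \<le> real q ^ 2 * tnorm (real q * w 0 + real (q choose 2) * \<alpha>)"
        by (auto simp: eventually_sequentially)
      obtain q where q: "q \<ge> n" "q \<ge> 1"
        "real q ^ (k - 2) * tnorm (real q * w 0 + real (q choose 2) * \<alpha>) < 1"
        using PRP_approx[OF w _ irr, of 1 n] k by auto
      have "real q ^ 2 * tnorm (real q * w 0 + real (q choose 2) * \<alpha>)
          \<le> real q ^ (k - 2) * tnorm (real q * w 0 + real (q choose 2) * \<alpha>)"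
        using q k by (intro mult_right_mono power_increasing tnorm_nonneg) auto
      then show False using n[OF q(1)] q(3) by linarith
    qed
    then have "w 0 \<in> N" using N(2) by auto
    moreover have "w \<in> extensional {..<k}" using w by (auto simp: PRP_def torus_def PiE_def)
    ultimately show "w \<in> PiE {..<k} ?A" by (auto simp: PiE_def)
  qed
  moreover have "PiE {..<k} ?A \<in> null_sets ?M"
  proof
    show "PiE {..<k} ?A \<in> sets ?M"
      using N(1) by (intro sets_PiM_I_finite) auto
    have "emeasure ?M (PiE {..<k} ?A) = (\<Prod>j<k. emeasure lborel (?A j))"
      using N(1) by (intro lborel_family.emeasure_PiM) auto
    \<comment> \<open>The remaining factors are infinite; in \<open>ennreal\<close> a zero factor
      still makes the product 0.\<close>
    also have "\<dots> = 0"
      using k N(1) by (intro prod_zero) (auto intro!: bexI[of _ 0])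
    finally show "emeasure ?M (PiE {..<k} ?A) = 0" .
  qed
  ultimately have "PRP k \<alpha> \<in> null_sets (completion ?M)"
    by (blast intro: null_sets_completion_subset null_sets_completionI)
  then show ?thesis by (simp add: MRP_def)
qed

text \<open>The implications form a circle: the liminf condition gives GRP, which gives MRP because
  the torus is a box of measure 1; MRP gives TRP, which returns the liminf condition.\<close>

lemma k_2_equivalences:
  assumes "\<alpha> \<notin> \<rat>"
  shows "(TRP 2 \<alpha> \<longleftrightarrow> MRP 2 \<alpha>) \<and> (MRP 2 \<alpha> \<longleftrightarrow> GRP 2 \<alpha>) \<and>
    (GRP 2 \<alpha> \<longleftrightarrow> liminf (\<lambda>q. ereal (real q * tnorm (real q * \<alpha>))) = 0)"
proof -
  let ?L = "liminf (\<lambda>q. ereal (real q * tnorm (real q * \<alpha>))) = 0"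
  have "TRP 2 \<alpha> \<longleftrightarrow> ?L" using TRP_iff_liminf[OF assms, of 2] by simp
  moreover have "?L \<Longrightarrow> GRP 2 \<alpha>"
  proof -
    assume ?L
    then have "\<forall>e>0. \<forall>N. \<exists>q\<ge>N. real q * tnorm (real q * \<alpha>) < e"
      by (subst (asm) liminf_ereal_eq_0_iff) (simp_all add: tnorm_nonneg)
    then show "GRP 2 \<alpha>" unfolding GRP_def by (intro PRP_2_eq_torus) blast
  qed
  moreover have "GRP 2 \<alpha> \<Longrightarrow> MRP 2 \<alpha>"
    by (rule MRP_I[where A = "\<lambda>_. {0..<1}"]) (auto simp: GRP_def torus_def)
  moreover have "MRP 2 \<alpha> \<Longrightarrow> TRP 2 \<alpha>" by (auto simp: MRP_def TRP_def)
  ultimately show ?thesis by blast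
qed

subsection \<open>Badly approximable numbers\<close>

definition badly_approximable :: "real \<Rightarrow> real set" where
  "badly_approximable c = {y. \<forall>m::nat. m \<ge> 1 \<longrightarrow> c \<le> real m * tnorm (real m * y)}"

lemma closed_badly_approximable: "closed (badly_approximable c)"
proof -
  have "badly_approximable c = (\<Inter>m\<in>{1..}. {y. c \<le> real m * tnorm (real m * y)})"
    by (auto simp: badly_approximable_def)
  also have "closed \<dots>"
    by (intro closed_INT ballI closed_Collect_le continuous_intros)
  finally show ?thesis .
qed

lemma badly_approximable_add_int:
  assumes "p \<in> \<int>" "x + p \<in> badly_approximable c"
  shows "x \<in> badly_approximable c"
proof -
  have "tnorm (real m * (x + p)) = tnorm (real m * x)" for m :: nat
    using assms(1) by (intro tnorm_cong) (simp add: algebra_simps)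
  then show ?thesis using assms(2) by (simp add: badly_approximable_def)
qed

text \<open>Around each fraction \<open>p / m\<close> the interval of radius
  \<open>c / m ^ 2\<close> misses the set. Dirichlet's theorem at the midpoint of the window
  supplies such a fraction with \<open>m\<close> bounded in terms of \<open>c\<close> and
  \<open>L\<close>, hence a hole of length proportional to \<open>L\<close>.\<close>

lemma badly_approximable_porous:
  assumes c: "0 < c" "c \<le> 1" and L: "0 < L" "L \<le> 1"
  obtains s where "u \<le> s" "s + c\<^sup>2 / 16 * L \<le> u + L"
    "{s<..<s + c\<^sup>2 / 16 * L} \<inter> badly_approximable c = {}"
proof -
  define h where "h = c\<^sup>2 / 16 * L"
  have "c\<^sup>2 \<le> 1" using c by (simp add: power_le_one)
  then have h: "0 < h" "h \<le> L / 4"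
    using mult_right_mono[of "c\<^sup>2" 1 L] c L by (auto simp: h_def)
  \<comment> \<open>The scale is balanced: \<open>v \<le> N\<close> gives
    \<open>1 / (c * N ^ 2) \<le> L / 4\<close>, and \<open>N \<le> 2 * v\<close> gives
    \<open>h * N ^ 2 \<le> c\<close>, hence \<open>h \<le> \<rho>\<close>.\<close>
  define v where "v = sqrt (4 / (c * L))"
  have v2: "v\<^sup>2 = 4 / (c * L)" using c L by (simp add: v_def)
  have "c * L \<le> 1 * 1" using c L by (intro mult_mono) auto
  then have "1 \<le> 4 / (c * L)" using c L by (simp add: field_simps)
  then have v1: "1 \<le> v" by (simp add: v_def)
  define N where "N = nat \<lceil>v\<rceil>"
  have N: "v \<le> real N" "real N \<le> 2 * v" using v1 by (auto simp: N_def) linarith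
  then have N1: "N \<ge> 1" using v1 by linarith
  have Nlow: "4 / (c * L) \<le> real N ^ 2" unfolding v2[symmetric] using N v1 by (intro power_mono) auto
  have "real N ^ 2 \<le> (2 * v) ^ 2" using N by (intro power_mono) auto
  then have Nup: "real N ^ 2 \<le> 16 / (c * L)" by (simp add: power_mult_distrib v2)
  define y where "y = u + L / 2"
  obtain m where m: "1 \<le> m" "m \<le> N" "tnorm (real m * y) < 1 / real N"
    using Dirichlet_tnorm[OF N1] by blast
  obtain p :: int where p: "tnorm (real m * y) = \<bar>real m * y - of_int p\<bar>"
    using tnorm_eq_dist by metis
  define x0 where "x0 = of_int p / real m"
  define \<rho> where "\<rho> = c / real m ^ 2"
  have scale: "\<bar>real m * x - of_int p\<bar> = real m * \<bar>x - x0\<bar>" for x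
  proof -
    have "real m * x - of_int p = real m * (x - x0)" using m(1) by (simp add: x0_def field_simps)
    then show ?thesis by (simp add: abs_mult)
  qed
  have dist: "\<bar>y - x0\<bar> < 1 / (real m * real N)"
  proof -
    have "real m * \<bar>y - x0\<bar> < 1 / real N" using m(3) unfolding p scale .
    then show ?thesis using m N1 by (simp add: field_simps)
  qed
  have "h * real m ^ 2 \<le> h * real N ^ 2" using m h by (intro mult_left_mono power_mono) auto
  also have "\<dots> \<le> h * (16 / (c * L))" using Nup h by (intro mult_left_mono) auto
  also have "\<dots> = c" using c L by (simp add: h_def power2_eq_square)
  finally have h_le: "h \<le> \<rho>" using m(1) by (simp add: \<rho>_def field_simps)
  have hole: "x \<notin> badly_approximable c" if "\<bar>x - x0\<bar> < \<rho>" for x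
  proof -
    have "tnorm (real m * x) \<le> real m * \<bar>x - x0\<bar>"
      using tnorm_le_dist_Ints[of "of_int p" "real m * x"] by (simp add: scale)
    then have "real m * tnorm (real m * x) \<le> real m * (real m * \<bar>x - x0\<bar>)"
      by (rule mult_left_mono) simp
    also have "\<dots> < c" using that m(1) by (simp add: \<rho>_def field_simps power2_eq_square)
    finally show ?thesis using m(1) by (force simp: badly_approximable_def)
  qed
  have "\<exists>s. u \<le> s \<and> s + h \<le> u + L \<and> x0 - \<rho> \<le> s \<and> s + h \<le> x0 + \<rho>"
  \<comment> \<open>If the hole contains \<open>y\<close>, go from \<open>y\<close> towards
    \<open>x0\<close>. Otherwise \<open>\<rho>\<close> is below the Dirichlet error, so
    \<open>m > c * N\<close>; the error is then less than \<open>L / 4\<close>, and the piece of the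
    hole starting at \<open>x0\<close> fits into the window.\<close>
  proof (cases "\<bar>y - x0\<bar> < \<rho>")
    case True
    show ?thesis
    proof (cases "y \<le> x0")
      case True
      then show ?thesis using \<open>\<bar>y - x0\<bar> < \<rho>\<close> h h_le L
        by (intro exI[of _ y]) (auto simp: y_def abs_le_iff abs_less_iff)
    next
      case False
      then show ?thesis using \<open>\<bar>y - x0\<bar> < \<rho>\<close> h h_le L
        by (intro exI[of _ "y - h"]) (auto simp: y_def abs_le_iff abs_less_iff)
    qed
  next
    case False
    with dist have "\<rho> < 1 / (real m * real N)" by linarith
    then have "c * real N < real m" using m(1) N1
      by (simp add: \<rho>_def field_simps power2_eq_square)
    then have "c * real N * real N \<le> real m * real N" by (intro mult_right_mono) auto
    then have "1 / (real m * real N) \<le> 1 / (c * real N * real N)"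
      using c N1 m(1) by (intro divide_left_mono mult_pos_pos) auto
    also have "\<dots> \<le> L / 4" using Nlow c L N1 by (simp add: field_simps power2_eq_square)
    finally have "\<bar>y - x0\<bar> < L / 4" using dist by linarith
    then have "u \<le> x0" "x0 + h \<le> u + L" using h unfolding y_def by linarith+
    then show ?thesis using h h_le by (intro exI[of _ x0]) auto
  qed
  then obtain s where s: "u \<le> s" "s + h \<le> u + L" "x0 - \<rho> \<le> s" "s + h \<le> x0 + \<rho>" by blast
  have "{s<..<s + h} \<inter> badly_approximable c = {}"
  proof -
    have "\<bar>x - x0\<bar> < \<rho>" if "x \<in> {s<..<s + h}" for x
      using that s(3,4) by (auto simp: abs_less_iff)
    then show ?thesis using hole by blast
  qed
  then show ?thesis using s(1,2) that by (simp add: h_def)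
qed

section \<open>From porosity to measure zero\<close>

lemma measure_badly_approximable_le:
  assumes c: "0 < c" "c \<le> 1" and L: "0 < L" "L \<le> 1"
  shows "measure lborel (badly_approximable c \<inter> {u..<u + L}) \<le> (1 - c\<^sup>2 / 16) * L"
proof -
  obtain s where s: "u \<le> s" "s + c\<^sup>2 / 16 * L \<le> u + L"
    "{s<..<s + c\<^sup>2 / 16 * L} \<inter> badly_approximable c = {}"
    using badly_approximable_porous[OF c L] by blast
  let ?H = "{s<..<s + c\<^sup>2 / 16 * L}"
  have "measure lborel (badly_approximable c \<inter> {u..<u + L}) \<le> measure lborel ({u..<u + L} - ?H)"
  proof (rule measure_mono_fmeasurable)
    show "badly_approximable c \<inter> {u..<u + L} \<subseteq> {u..<u + L} - ?H" using s(3) by blast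
    show "badly_approximable c \<inter> {u..<u + L} \<in> sets lborel"
      using closed_badly_approximable by (auto intro: borel_closed)
    show "{u..<u + L} - ?H \<in> fmeasurable lborel"
      using L by (intro fmeasurable.Diff) (auto simp: fmeasurable_def)
  qed
  also have "\<dots> = measure lborel {u..<u + L} - measure lborel ?H"
    using s L by (intro measure_Diff) auto
  also have "\<dots> = (1 - c\<^sup>2 / 16) * L"
    using L c by (simp add: measure_def algebra_simps)
  finally show ?thesis .
qed

text \<open>A density argument by hand: enclose the compact set \<open>A\<close> in an open
  \<open>T\<close> with excess measure below \<open>e\<close>, and use a grid so fine that the cells
  meeting \<open>A\<close> lie in \<open>T\<close>. In each cell \<open>A\<close> fills at most the
  fraction \<open>1 - k\<close>, so \<open>|A| \<le> (1 - k) (|A| + e)\<close> for every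
  \<open>e > 0\<close>.\<close>

lemma null_badly_approximable_unit:
  assumes c: "0 < c" "c \<le> 1"
  shows "measure lborel (badly_approximable c \<inter> {0..1}) = 0"
proof -
  define A where "A = badly_approximable c \<inter> {0..1}"
  define k where "k = c\<^sup>2 / 16"
  have "c\<^sup>2 \<le> 1" using c by (simp add: power_le_one)
  then have k: "0 < k" "k \<le> 1" using c by (auto simp: k_def)
  have "compact A" unfolding A_def using closed_badly_approximable by (intro closed_Int_compact) auto
  then have A: "A \<in> sets borel" and A_fm: "A \<in> fmeasurable lborel"
    by (auto intro: borel_compact fmeasurable_compact)
  have "k * measure lborel A \<le> e" if e: "e > 0" for e
  proof -
    obtain T where T: "open T" "A \<subseteq> T" "emeasure lebesgue (T - A) < ennreal e"
      using sets_lebesgue_outer_open[of A e] A e by auto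
    have TA: "T - A \<in> sets borel" using T(1) A by auto
    with T(3) have TA_e: "emeasure lborel (T - A) < ennreal e" by simp
    then have TA_fm: "T - A \<in> fmeasurable lborel"
      using TA by (auto simp: fmeasurable_def intro: less_trans)
    have "ennreal (measure lborel (T - A)) < ennreal e"
      using TA_e emeasure_eq_measure2[OF TA_fm] by simp
    then have TA_m: "measure lborel (T - A) < e" by (simp add: ennreal_less_iff)
    have T_eq: "T = A \<union> (T - A)" using T(2) by blast
    have T_fm: "T \<in> fmeasurable lborel"
      by (subst T_eq) (intro fmeasurable.Un A_fm TA_fm)
    have "measure lborel T \<le> measure lborel A + measure lborel (T - A)"
      using measure_Un_le[of A lborel "T - A"] A TA T_eq by simp
    with TA_m have T_m: "measure lborel T \<le> measure lborel A + e" by linarith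
    obtain d where d: "d > 0" "(\<Union>x\<in>A. ball x d) \<subseteq> T"
      using compact_subset_open_imp_ball_epsilon_subset[OF \<open>compact A\<close> T(1,2)] by blast
    obtain n :: nat where n: "n \<ge> 1" "1 / real n < d"
    proof -
      obtain n where "inverse (real (Suc n)) < d" using d(1) reals_Archimedean by blast
      then show ?thesis using that[of "Suc n"] by (simp add: divide_inverse)
    qed
    define I where "I i = {real i / real n..<real i / real n + 1 / real n}" for i
    \<comment> \<open>The index \<open>i = n\<close> is included because the cells are half-open and
      \<open>A\<close> may contain 1.\<close>
    define J where "J = {i. i \<le> n \<and> I i \<inter> A \<noteq> {}}"
    have "finite J" by (simp add: J_def)
    have I_T: "I i \<subseteq> T" if "i \<in> J" for i
    proof
      fix x assume x: "x \<in> I i"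
      obtain y where y: "y \<in> I i" "y \<in> A" using \<open>i \<in> J\<close> by (auto simp: J_def)
      have "dist y x < d" using x y(1) n(2) by (auto simp: I_def dist_real_def abs_if)
      then have "x \<in> ball y d" by simp
      then show "x \<in> T" using d(2) y(2) by blast
    qed
    have A_I: "A \<subseteq> (\<Union>i\<in>J. A \<inter> I i)"
    proof
      fix x assume x: "x \<in> A"
      then have x01: "0 \<le> x" "x \<le> 1" by (auto simp: A_def)
      define i where "i = nat \<lfloor>real n * x\<rfloor>"
      have i: "real i \<le> real n * x" "real n * x < real i + 1"
        using x01 by (auto simp: i_def)
      have "real n * x \<le> real n * 1" using x01 by (intro mult_left_mono) auto
      then have "i \<le> n" using i(1) by linarith
      moreover have "x \<in> I i" using i n(1) by (auto simp: I_def field_simps)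
      ultimately show "x \<in> (\<Union>i\<in>J. A \<inter> I i)" using x by (auto simp: J_def)
    qed
    have I_sets: "I i \<in> sets lborel" and I_fin: "emeasure lborel (I i) \<noteq> \<infinity>" for i
      by (simp_all add: I_def)
    have I_disj: "disjoint_family_on I J"
    proof -
      have "I i \<inter> I j = {}" if "i < j" for i j
      proof -
        have "real i / real n + 1 / real n = real (Suc i) / real n" by (simp add: add_divide_distrib)
        also have "\<dots> \<le> real j / real n" using that by (intro divide_right_mono) auto
        finally show ?thesis by (auto simp: I_def)
      qed
      then show ?thesis unfolding disjoint_family_on_def by (metis inf_commute linorder_neqE_nat)
    qed
    have I_m: "measure lborel (I i) = 1 / real n" for i
      by (simp add: I_def measure_def)
    have "measure lborel A \<le> measure lborel (\<Union>i\<in>J. A \<inter> I i)"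
      using A_I A I_sets \<open>finite J\<close> A_fm
      by (intro measure_mono_fmeasurable fmeasurable.finite_UN) (auto intro!: fmeasurable_Int_fmeasurable)
    also have "\<dots> \<le> (\<Sum>i\<in>J. measure lborel (A \<inter> I i))"
      using A I_sets \<open>finite J\<close> by (intro measure_UNION_le) auto
    also have "\<dots> \<le> (\<Sum>i\<in>J. (1 - k) * (1 / real n))"
    proof (rule sum_mono)
      fix i
      have "measure lborel (A \<inter> I i) \<le> measure lborel (badly_approximable c \<inter> I i)"
      proof (rule measure_mono_fmeasurable)
        show "badly_approximable c \<inter> I i \<in> fmeasurable lborel"
          using closed_badly_approximable[of c] I_sets[of i]
          by (subst Int_commute, intro fmeasurable_Int_fmeasurable)
             (auto simp: I_def fmeasurable_def)
      qed (use A I_sets in \<open>auto simp: A_def\<close>)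
      also have "\<dots> \<le> (1 - k) * (1 / real n)"
        unfolding I_def k_def using c n(1) by (intro measure_badly_approximable_le) auto
      finally show "measure lborel (A \<inter> I i) \<le> (1 - k) * (1 / real n)" .
    qed
    also have "\<dots> = (1 - k) * (\<Sum>i\<in>J. measure lborel (I i))"
      by (simp add: I_m)
    also have "(\<Sum>i\<in>J. measure lborel (I i)) = measure lborel (\<Union>i\<in>J. I i)"
      using \<open>finite J\<close> I_sets I_disj I_fin by (intro measure_finite_Union[symmetric]) auto
    also have "(1 - k) * \<dots> \<le> (1 - k) * measure lborel T"
      using k I_T I_sets \<open>finite J\<close> T_fm by (intro mult_left_mono measure_mono_fmeasurable) auto
    also have "\<dots> \<le> (1 - k) * (measure lborel A + e)"
      using k T_m by (intro mult_left_mono) auto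
    finally have "k * measure lborel A \<le> (1 - k) * e" by (simp add: algebra_simps)
    also have "\<dots> \<le> e" using k e by (simp add: algebra_simps)
    finally show ?thesis .
  qed
  then have "k * measure lborel A \<le> 0" by (rule field_le_epsilon) simp
  then have "measure lborel A \<le> 0" using k by (simp add: mult_le_0_iff)
  then show ?thesis unfolding A_def by (simp add: measure_le_0_iff)
qed

text \<open>Passing to \<open>min c 1\<close> only enlarges the set and meets the bound
  \<open>c \<le> 1\<close> of the porosity estimate; by periodicity the integer translates of the
  part in the unit interval cover everything.\<close>

lemma negligible_badly_approximable:
  assumes "0 < c"
  shows "negligible (badly_approximable c)"
proof -
  define c' where "c' = min c 1"
  define A where "A = badly_approximable c' \<inter> {0..1}"
  have c': "0 < c'" "c' \<le> 1" using assms by (auto simp: c'_def)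
  have "compact A" unfolding A_def using closed_badly_approximable by (intro closed_Int_compact) auto
  then have A: "A \<in> sets borel" and A_fm: "A \<in> fmeasurable lborel"
    by (auto intro: borel_compact fmeasurable_compact)
  have "emeasure lborel A = 0"
    using emeasure_eq_measure2[OF A_fm] null_badly_approximable_unit[OF c'] by (simp add: A_def)
  then have "A \<in> null_sets lborel" using A by (simp add: null_sets_def)
  then have "negligible A" unfolding negligible_iff_null_sets by (rule null_sets_completionI)
  then have "negligible (\<Union>n::int. (+) (of_int n) ` A)"
    by (intro negligible_countable_Union) (auto intro: negligible_translation)
  moreover have "badly_approximable c \<subseteq> (\<Union>n::int. (+) (of_int n) ` A)"
  proof
    fix x assume "x \<in> badly_approximable c"
    then have "x \<in> badly_approximable c'"
      by (auto simp: badly_approximable_def c'_def intro: order_trans)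
    then have "frac x + of_int \<lfloor>x\<rfloor> \<in> badly_approximable c'" by (simp add: frac_def)
    then have "frac x \<in> badly_approximable c'" by (rule badly_approximable_add_int[rotated]) simp
    then have "frac x \<in> A" using frac_lt_1[of x] by (simp add: A_def)
    moreover have "x = of_int \<lfloor>x\<rfloor> + frac x" by (simp add: frac_def)
    ultimately show "x \<in> (\<Union>n::int. (+) (of_int n) ` A)" by blast
  qed
  ultimately show ?thesis by (rule negligible_subset)
qed

text \<open>If no \<open>m\<close> works for \<open>x\<close>, then \<open>b * x\<close> is badly
  approximable with constant \<open>e / b\<close>, so such \<open>x\<close> form a null set. The
  sets for growing \<open>M\<close> therefore exhaust the unit interval up to measure zero, and
  continuity from below gives \<open>M\<close>.\<close>

lemma many_well_approximable:
  assumes b: "b \<ge> 1" and e: "e > 0"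
  shows "\<exists>M\<ge>1. 1/2 \<le> measure lborel
    {x \<in> {0..<1}. \<exists>m\<in>{1..M}. real (b * m) * tnorm (real (b * m) * x) < e}"
proof -
  define E where "E M = {x \<in> {0..<1::real}. \<exists>m\<in>{1..M}. real (b * m) * tnorm (real (b * m) * x) < e}"
    for M
  have E_sets: "E M \<in> sets lborel" for M
    unfolding E_def by measurable
  have "incseq E" unfolding E_def incseq_def by fastforce
  have sub: "(\<Union>M. E M) \<subseteq> {0..<1}" by (auto simp: E_def)
  define B where "B = (\<lambda>y. y / real b) ` badly_approximable (e / real b)"
  have "(\<lambda>y. y / real b) differentiable_on badly_approximable (e / real b)"
    by (intro linear_imp_differentiable_on linearI) (auto simp: add_divide_distrib)
  then have "negligible B"
    unfolding B_def using b e
    by (intro negligible_differentiable_image_negligible negligible_badly_approximable) auto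
  then have B: "B \<in> null_sets lebesgue" by (simp add: negligible_iff_null_sets)
  have cover: "{0..<1} \<subseteq> (\<Union>M. E M) \<union> B"
  proof
    fix x :: real assume x: "x \<in> {0..<1}"
    show "x \<in> (\<Union>M. E M) \<union> B"
    proof (rule ccontr)
      assume neg: "x \<notin> (\<Union>M. E M) \<union> B"
      have "e / real b \<le> real m * tnorm (real m * (real b * x))" if "m \<ge> 1" for m
      proof -
        have "x \<notin> E m" using neg by auto
        then have "e \<le> real (b * m) * tnorm (real (b * m) * x)"
          using x that by (auto simp: E_def not_less)
        then show ?thesis using b by (simp add: field_simps)
      qed
      then have "real b * x \<in> badly_approximable (e / real b)" by (simp add: badly_approximable_def)
      then have "real b * x / real b \<in> B" unfolding B_def by (rule imageI)
      then show False using neg b by simp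
    qed
  qed
  have "emeasure lborel {0..<1::real} = emeasure lebesgue {0..<1::real}" by simp
  also have "\<dots> \<le> emeasure lebesgue ((\<Union>M. E M) \<union> B)"
    using cover E_sets B by (intro emeasure_mono) auto
  also have "\<dots> = emeasure lebesgue (\<Union>M. E M)"
    using E_sets B by (intro emeasure_Un_null_set) auto
  also have "\<dots> = emeasure lborel (\<Union>M. E M)" using E_sets by simp
  finally have ge: "1 \<le> emeasure lborel (\<Union>M. E M)" by simp
  have le: "emeasure lborel (\<Union>M. E M) \<le> 1"
    using emeasure_mono[OF sub, of lborel] by simp
  with ge have one: "emeasure lborel (\<Union>M. E M) = 1" by (rule antisym[rotated])
  then have "(\<lambda>M. measure lborel (E M)) \<longlonglongrightarrow> measure lborel (\<Union>M. E M)"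
    using E_sets \<open>incseq E\<close> by (intro Lim_measure_incseq) auto
  then have "(\<lambda>M. measure lborel (E M)) \<longlonglongrightarrow> 1"
    using one by (simp add: measure_def)
  then have "\<forall>\<^sub>F M in sequentially. 1/2 < measure lborel (E M)"
    by (rule order_tendstoD) simp
  then obtain M0 where "\<And>M. M \<ge> M0 \<Longrightarrow> 1/2 < measure lborel (E M)"
    by (auto simp: eventually_sequentially)
  then have "1/2 < measure lborel (E (max 1 M0))" by simp
  then show ?thesis unfolding E_def by (intro exI[of _ "max 1 M0"]) (auto intro: less_imp_le)
qed

subsection \<open>The residual set for three dimensions\<close>

text \<open>All gaps at period \<open>q = 6 m p\<close> are integer combinations of
  \<open>p * \<alpha>\<close>, \<open>p * w 0\<close> and \<open>p * w 1\<close>. The hypothesis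
  controls the first two with the required weights; \<open>w 1\<close> is arbitrary and is handled
  by the bounded Dirichlet multiplier \<open>m\<close>.\<close>

lemma PRP_3_I:
  assumes w: "w \<in> torus 3"
    and small: "\<And>e. e > 0 \<Longrightarrow>
      \<exists>q\<ge>1. real q ^ 2 * tnorm (real q * \<alpha>) < e \<and> real q * tnorm (real q * w 0) < e"
  shows "w \<in> PRP 3 \<alpha>"
proof -
  have "repetition 3 (\<lambda>n. (skew 3 \<alpha> ^^ n) w)"
  proof (rule repetition_skewI)
    fix e :: real assume e: "e > 0"
    obtain M :: nat where M: "M \<ge> 1" "12 / e \<le> real M"
      using real_arch_simple[of "max 1 (12 / e)"] by auto
    \<comment> \<open>Here \<open>432\<close> is twice \<open>216 = 6 ^ 3\<close>, the largest
      coefficient arising below, and \<open>M ^ 3\<close> absorbs the powers of \<open>m\<close>. As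
      before, \<open>M\<close> is fixed before \<open>p\<close>.\<close>
    define d where "d = e / (432 * real M ^ 3)"
    have "d > 0" using e M(1) by (simp add: d_def)
    with small obtain p where p: "p \<ge> 1" "real p ^ 2 * tnorm (real p * \<alpha>) < d"
      "real p * tnorm (real p * w 0) < d" by blast
    obtain m where m: "1 \<le> m" "m \<le> M" "tnorm (real m * (real p * w 1)) < 1 / real M"
      using Dirichlet_tnorm[OF M(1)] by blast
    define a where "a = tnorm (real p * \<alpha>)"
    define b where "b = tnorm (real p * w 0)"
    have ab: "0 \<le> a" "0 \<le> b" by (simp_all add: a_def b_def tnorm_nonneg)
    \<comment> \<open>The factor 6 clears the denominators of \<open>q choose 2\<close> and
      \<open>q choose 3\<close>, making both multiples of \<open>p\<close>.\<close>
    define q where "q = 6 * m * p"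
    have "2 * (q choose 2) = q * (q - 1)"
      using binomial_absorption[of 1 q] by (simp add: numeral_2_eq_2)
    also have "\<dots> = 2 * (3 * m * (q - 1) * p)" by (subst (1) q_def) simp
    finally have choose2: "q choose 2 = 3 * m * (q - 1) * p" by simp
    have "3 * (q choose 3) = q * (q - 1 choose 2)"
      using binomial_absorption[of 2 q] by (simp add: numeral_3_eq_3 numeral_2_eq_2)
    moreover have "2 * (q - 1 choose 2) = (q - 1) * (q - 2)"
      using binomial_absorption[of 1 "q - 1"] by (simp add: numeral_2_eq_2)
    ultimately have "2 * (3 * (q choose 3)) = q * ((q - 1) * (q - 2))"
      by (metis mult.left_commute)
    also have "\<dots> = 2 * (3 * (m * ((q - 1) * (q - 2)) * p))" by (subst (1) q_def) simp
    finally have choose3: "q choose 3 = m * ((q - 1) * (q - 2)) * p" by simp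
    have Md: "432 * (real M ^ 3 * d) = e" using M(1) by (simp add: d_def)
    have m3: "real m ^ i \<le> real M ^ 3" if "i \<le> 3" for i
    proof -
      have "real m ^ i \<le> real M ^ i" using m(2) by (intro power_mono) auto
      also have "\<dots> \<le> real M ^ 3" using M(1) that by (intro power_increasing) auto
      finally show ?thesis .
    qed
    have bound_a: "432 * (real m ^ 3 * (real p ^ 2 * a)) \<le> e"
    proof -
      have "real m ^ 3 * (real p ^ 2 * a) \<le> real M ^ 3 * d"
        using m3[of 3] p(2) ab by (intro mult_mono) (auto simp: a_def)
      then show ?thesis using Md by linarith
    qed
    have bound_b: "432 * (real m ^ 2 * (real p * b)) \<le> e"
    proof -
      have "real m ^ 2 * (real p * b) \<le> real M ^ 3 * d"
        using m3[of 2] p(3) ab by (intro mult_mono) (auto simp: b_def)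
      then show ?thesis using Md by linarith
    qed
    have "real q ^ (3 - 1 - j) * tnorm (gap \<alpha> w q j 0) \<le> e" if j: "j < 3" for j
    proof -
      consider "j = 0" | "j = 1" | "j = 2" using j by linarith
      then show ?thesis
      proof cases
        case 1
        have "tnorm (real q * \<alpha>) \<le> real (6 * m) * a"
          using tnorm_nat_mult[of "6 * m" "real p * \<alpha>"] by (simp add: q_def a_def mult.assoc)
        then have "real q ^ 2 * tnorm (real q * \<alpha>) \<le> real q ^ 2 * (real (6 * m) * a)"
          by (rule mult_left_mono) simp
        also have "\<dots> = 216 * (real m ^ 3 * (real p ^ 2 * a))"
          by (simp add: q_def power2_eq_square power3_eq_cube)
        also have "\<dots> \<le> e" using bound_a e by linarith
        finally show ?thesis using 1 by (simp add: gap_0 numeral_2_eq_2)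
      next
        case 2
        have "gap \<alpha> w q 1 0 = real (6 * m) * (real p * w 0) + real (3 * m * (q - 1)) * (real p * \<alpha>)"
          unfolding gap_1 choose2 by (simp add: q_def)
        then have "tnorm (gap \<alpha> w q 1 0) \<le> real (6 * m) * b + real (3 * m * (q - 1)) * a"
          unfolding a_def b_def
          by (simp only:) (rule order_trans[OF tnorm_add], intro add_mono tnorm_nat_mult)
        also have "\<dots> \<le> real (6 * m) * b + real (3 * m * q) * a"
          using ab by (intro add_mono mult_right_mono of_nat_mono mult_le_mono) auto
        finally have "real q * tnorm (gap \<alpha> w q 1 0) \<le> real q * (real (6 * m) * b + real (3 * m * q) * a)"
          by (rule mult_left_mono) simp
        also have "\<dots> = 36 * (real m ^ 2 * (real p * b)) + 108 * (real m ^ 3 * (real p ^ 2 * a))"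
          by (simp add: q_def power2_eq_square power3_eq_cube algebra_simps)
        also have "\<dots> \<le> e" using bound_a bound_b e by linarith
        finally show ?thesis using 2 by simp
      next
        case 3
        have "gap \<alpha> w q 2 0 = real 6 * (real m * (real p * w 1)) +
            (real (3 * m * (q - 1)) * (real p * w 0) + real (m * ((q - 1) * (q - 2))) * (real p * \<alpha>))"
          unfolding gap_2 choose2 choose3 by (simp add: q_def)
        then have "tnorm (gap \<alpha> w q 2 0) \<le> real 6 * tnorm (real m * (real p * w 1)) +
            (real (3 * m * (q - 1)) * b + real (m * ((q - 1) * (q - 2))) * a)"
          unfolding a_def b_def
          by (simp only:) (rule order_trans[OF tnorm_add], intro add_mono tnorm_nat_mult
              order_trans[OF tnorm_add])
        also have "\<dots> \<le> real 6 * (1 / real M) + (real (3 * m * q) * b + real (m * (q * q)) * a)"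
          using ab m(3)
          by (intro add_mono mult_right_mono mult_left_mono of_nat_mono mult_le_mono) auto
        also have "\<dots> = 6 / real M + 18 * (real m ^ 2 * (real p * b)) + 36 * (real m ^ 3 * (real p ^ 2 * a))"
          by (simp add: q_def power2_eq_square power3_eq_cube)
        also have "6 / real M \<le> e / 2" using M e by (simp add: field_simps)
        finally have "tnorm (gap \<alpha> w q 2 0) \<le> e" using bound_a bound_b e by linarith
        then show ?thesis using 3 by simp
      qed
    qed
    moreover have "q \<ge> 1" using p(1) m(1) by (simp add: q_def Suc_le_eq)
    ultimately show "\<exists>q\<ge>1. \<forall>j<3. real q ^ (3 - 1 - j) * tnorm (gap \<alpha> w q j 0) \<le> e" by blast
  qed
  then show ?thesis using w by (simp add: PRP_def)
qed

text \<open>\<open>M\<close> depends only on \<open>n\<close> and \<open>b\<close>, so it is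
  available when the radius around \<open>a / b\<close> is chosen. The resulting sets
  \<open>U n\<close> are open and contain all rationals, hence are dense.\<close>

lemma residual_MRP_3: "\<exists>R. residual R \<and> (\<forall>\<alpha>\<in>R. MRP 3 \<alpha>)"
proof -
  define \<epsilon> where "\<epsilon> n = 1 / real (Suc n)" for n
  have \<epsilon>: "0 < \<epsilon> n" for n by (simp add: \<epsilon>_def)
  define M where "M n b = (SOME M. M \<ge> 1 \<and> 1/2 \<le> measure lborel
    {x \<in> {0..<1}. \<exists>m\<in>{1..M}. real (b * m) * tnorm (real (b * m) * x) < \<epsilon> n})" for n b
  have M: "M n b \<ge> 1" "1/2 \<le> measure lborel
    {x \<in> {0..<1}. \<exists>m\<in>{1..M n b}. real (b * m) * tnorm (real (b * m) * x) < \<epsilon> n}"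
    if "b \<ge> 1" for n b
    using someI_ex[OF many_well_approximable[OF that \<epsilon>[of n]]] unfolding M_def by blast+
  \<comment> \<open>For \<alpha> within \<open>\<rho> n b\<close> of \<open>a / b\<close> and
    \<open>q = b * m\<close> with \<open>m \<le> M n b\<close>, this gives \<open>q ^ 2 * tnorm (q *
    \<alpha>) \<le> q ^ 3 * |\<alpha> - a / b| < \<epsilon> n\<close>.\<close>
  define \<rho> where "\<rho> n b = \<epsilon> n / real (b * M n b) ^ 3" for n b
  define U where "U n = (\<Union>b\<in>{1..}. \<Union>a::int. ball (of_int a / real b) (\<rho> n b))" for n
  have \<rho>: "0 < \<rho> n b" if "b \<ge> 1" for n b
  proof -
    have "0 < b * M n b" using M(1)[OF that, of n] that by simp
    then have "0 < real (b * M n b) ^ 3" by (intro zero_less_power) (simp only: of_nat_0_less_iff)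
    then show ?thesis unfolding \<rho>_def using \<epsilon> by (rule divide_pos_pos[rotated])
  qed
  have "residual (\<Inter>n. U n)"
    unfolding residual_def
  proof (intro exI[of _ U] conjI allI order_refl)
    fix n
    show "open (U n)" unfolding U_def by (intro open_UN ballI open_ball)
    have Rats: "\<rat> \<subseteq> U n"
    proof
      fix x :: real assume "x \<in> \<rat>"
      then obtain a :: int and b :: nat where x: "b \<noteq> 0" "x = of_int a / real b"
        by (metis Rats_cases' of_int_of_nat_eq of_nat_0_less_iff pos_int_cases less_irrefl)
      then have "x \<in> ball (of_int a / real b) (\<rho> n b)" using \<rho>[of b n] by simp
      then show "x \<in> U n" using x(1) unfolding U_def by (auto simp: Suc_le_eq)
    qed
    have "x \<in> closure (U n)" for x
      unfolding closure_approachable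
    proof (intro allI impI)
      fix e :: real assume "e > 0"
      then obtain r where "r \<in> \<rat>" "x < r" "r < x + e"
        using Rats_dense_in_real[of x "x + e"] by auto
      then show "\<exists>y\<in>U n. dist y x < e"
        using Rats by (intro bexI[of _ r]) (auto simp: dist_real_def)
    qed
    then show "closure (U n) = UNIV" by blast
  qed
  moreover have "MRP 3 \<alpha>" if \<alpha>: "\<alpha> \<in> (\<Inter>n. U n)" for \<alpha>
  proof -
    \<comment> \<open>One \<open>q\<close> must serve \<alpha> and \<open>x\<close> together; since
      all multiples \<open>b * m\<close> with \<open>m \<le> M n b\<close> suit \<alpha>, the choice
      of \<open>m\<close> may depend on \<open>x\<close>.\<close>
    define W where "W n = {x \<in> {0..<1::real}. \<exists>q\<ge>1. real q ^ 2 * tnorm (real q * \<alpha>) < \<epsilon> n \<and>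
      real q * tnorm (real q * x) < \<epsilon> n}" for n
    have W_sets: "W n \<in> sets lborel" for n unfolding W_def by measurable
    have W_fm: "W n \<in> fmeasurable lborel" for n
    proof -
      have "emeasure lborel (W n) \<le> emeasure lborel {0..<1::real}"
        by (intro emeasure_mono) (auto simp: W_def)
      then show ?thesis using W_sets by (auto simp: fmeasurable_def intro: le_less_trans)
    qed
    have W_m: "1/2 \<le> measure lborel (W n)" for n
    proof -
      obtain a b where b: "b \<ge> 1" and near: "\<alpha> \<in> ball (of_int a / real b) (\<rho> n b)"
        using InterD[OF \<alpha>, of "U n"] by (auto simp: U_def)
      have "real (b * m) ^ 2 * tnorm (real (b * m) * \<alpha>) < \<epsilon> n" if m: "m \<in> {1..M n b}" for m
      proof -
        have "tnorm (real (b * m) * \<alpha>) \<le> \<bar>real (b * m) * \<alpha> - of_int (a * int m)\<bar>"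
          by (rule tnorm_le_dist_Ints) simp
        also have "real (b * m) * \<alpha> - of_int (a * int m) = real (b * m) * (\<alpha> - of_int a / real b)"
          using b by (simp add: field_simps)
        finally have "real (b * m) ^ 2 * tnorm (real (b * m) * \<alpha>)
            \<le> real (b * m) ^ 2 * (real (b * m) * \<bar>\<alpha> - of_int a / real b\<bar>)"
          by (intro mult_left_mono) (auto simp: abs_mult)
        also have "\<dots> = real (b * m) ^ 3 * \<bar>\<alpha> - of_int a / real b\<bar>"
          by (simp add: power2_eq_square power3_eq_cube)
        also have "\<dots> \<le> real (b * M n b) ^ 3 * \<bar>\<alpha> - of_int a / real b\<bar>"
          using m by (intro mult_right_mono power_mono of_nat_mono mult_le_mono) auto
        also have "\<dots> < real (b * M n b) ^ 3 * \<rho> n b"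
          using near b M(1)[OF b, of n]
          by (intro mult_strict_left_mono zero_less_power) (auto simp: dist_real_def abs_minus_commute)
        also have "\<dots> = \<epsilon> n" using b M(1)[OF b, of n] by (simp add: \<rho>_def)
        finally show ?thesis .
      qed
      then have "{x \<in> {0..<1}. \<exists>m\<in>{1..M n b}. real (b * m) * tnorm (real (b * m) * x) < \<epsilon> n} \<subseteq> W n"
        using b unfolding W_def by (fastforce intro: exI[of _ "b * _"])
      then have "measure lborel {x \<in> {0..<1}. \<exists>m\<in>{1..M n b}. real (b * m) * tnorm (real (b * m) * x) < \<epsilon> n}
          \<le> measure lborel (W n)"
        by (rule measure_mono_fmeasurable) (measurable, rule W_fm)
      with M(2)[OF b, of n] show ?thesis by linarith
    qed
    \<comment> \<open>Monotonicity lets continuity from above preserve the lower bound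
      \<open>1/2\<close> for the points that lie in every \<open>W n\<close>.\<close>
    have "decseq W"
    proof (rule decseq_SucI)
      fix n
      have "\<epsilon> (Suc n) \<le> \<epsilon> n" by (simp add: \<epsilon>_def field_simps)
      then show "W (Suc n) \<subseteq> W n" unfolding W_def by (blast intro: less_le_trans)
    qed
    then have "(\<lambda>n. measure lborel (W n)) \<longlonglongrightarrow> measure lborel (\<Inter>n. W n)"
      using W_sets fmeasurableD2[OF W_fm] by (intro Lim_measure_decseq) auto
    then have "1/2 \<le> measure lborel (\<Inter>n. W n)"
      by (rule LIMSEQ_le_const) (use W_m in auto)
    then have W_pos: "emeasure lborel (\<Inter>n. W n) \<noteq> 0" by (auto simp: measure_def)
    show "MRP 3 \<alpha>"
    proof (rule MRP_I)
      let ?A = "\<lambda>j :: nat. if j = 0 then \<Inter>n. W n else {0..<1}"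
      show "?A j \<in> sets borel" for j using W_sets by (auto intro!: sets.countable_INT)
      show "emeasure lborel (?A j) \<noteq> 0" for j using W_pos by auto
      show "PiE {..<3} ?A \<subseteq> PRP 3 \<alpha>"
      proof
        fix w assume w: "w \<in> PiE {..<3} ?A"
        have "w 0 \<in> ?A 0" using w by (rule PiE_mem) simp
        then have w0: "w 0 \<in> W n" for n by auto
        show "w \<in> PRP 3 \<alpha>"
        proof (rule PRP_3_I)
          have "?A j \<subseteq> {0..<1}" for j by (auto simp: W_def)
          then show "w \<in> torus 3" unfolding torus_def using w PiE_mono by blast
          fix e :: real assume "e > 0"
          then obtain n where n: "\<epsilon> n < e"
            using reals_Archimedean by (auto simp: \<epsilon>_def divide_inverse)
          from w0[of n] obtain q where "q \<ge> 1" "real q ^ 2 * tnorm (real q * \<alpha>) < \<epsilon> n"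
            "real q * tnorm (real q * w 0) < \<epsilon> n" by (auto simp: W_def)
          with n show "\<exists>q\<ge>1. real q ^ 2 * tnorm (real q * \<alpha>) < e \<and> real q * tnorm (real q * w 0) < e"
            by (meson less_trans)
        qed
      qed
    qed
  qed
  ultimately show ?thesis by blast
qed

theorem theorem1:
  shows
   "(\<forall>(\<alpha>::real) (k::nat). \<alpha> \<notin> \<rat> \<longrightarrow> k \<ge> 2 \<longrightarrow>
        (TRP k \<alpha> \<longleftrightarrow>
         liminf (\<lambda>q::nat. ereal (real q ^ (k - 1) * tnorm (real q * \<alpha>))) = 0))
    \<and> (\<forall>\<alpha>::real. \<alpha> \<notin> \<rat> \<longrightarrow>
        (TRP 2 \<alpha> \<longleftrightarrow> MRP 2 \<alpha>) \<and> (MRP 2 \<alpha> \<longleftrightarrow> GRP 2 \<alpha>) \<and>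
        (GRP 2 \<alpha> \<longleftrightarrow> liminf (\<lambda>q::nat. ereal (real q * tnorm (real q * \<alpha>))) = 0))
    \<and> (\<forall>(\<alpha>::real) (k::nat). \<alpha> \<notin> \<rat> \<longrightarrow> k \<ge> 3 \<longrightarrow> \<not> GRP k \<alpha>)
    \<and> (\<forall>k::nat. k \<ge> 3 \<longrightarrow> (AE \<alpha> in lborel. \<alpha> \<notin> \<rat> \<longrightarrow> \<not> TRP k \<alpha>))
    \<and> (\<exists>R. residual R \<and> (\<forall>\<alpha>\<in>R. \<alpha> \<notin> \<rat> \<longrightarrow> MRP 3 \<alpha>))
    \<and> (\<forall>(\<alpha>::real) (k::nat). \<alpha> \<notin> \<rat> \<longrightarrow> k \<ge> 4 \<longrightarrow> \<not> MRP k \<alpha>)"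
proof (intro conjI)
  show "\<forall>(\<alpha>::real) (k::nat). \<alpha> \<notin> \<rat> \<longrightarrow> k \<ge> 2 \<longrightarrow>
        (TRP k \<alpha> \<longleftrightarrow>
         liminf (\<lambda>q::nat. ereal (real q ^ (k - 1) * tnorm (real q * \<alpha>))) = 0)"
    using TRP_iff_liminf by blast
  show "\<forall>\<alpha>::real. \<alpha> \<notin> \<rat> \<longrightarrow>
        (TRP 2 \<alpha> \<longleftrightarrow> MRP 2 \<alpha>) \<and> (MRP 2 \<alpha> \<longleftrightarrow> GRP 2 \<alpha>) \<and>
        (GRP 2 \<alpha> \<longleftrightarrow> liminf (\<lambda>q::nat. ereal (real q * tnorm (real q * \<alpha>))) = 0)"
    using k_2_equivalences by blast
  show "\<forall>(\<alpha>::real) (k::nat). \<alpha> \<notin> \<rat> \<longrightarrow> k \<ge> 3 \<longrightarrow> \<not> GRP k \<alpha>"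
    using PRP_ne_torus by (simp add: GRP_def)
  show "\<forall>k::nat. k \<ge> 3 \<longrightarrow> (AE \<alpha> in lborel. \<alpha> \<notin> \<rat> \<longrightarrow> \<not> TRP k \<alpha>)"
    using AE_not_TRP by blast
  show "\<exists>R. residual R \<and> (\<forall>\<alpha>\<in>R. \<alpha> \<notin> \<rat> \<longrightarrow> MRP 3 \<alpha>)"
    using residual_MRP_3 by blast
  show "\<forall>(\<alpha>::real) (k::nat). \<alpha> \<notin> \<rat> \<longrightarrow> k \<ge> 4 \<longrightarrow> \<not> MRP k \<alpha>"
    using not_MRP by blast
qed

end
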